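(* Let $N\ge 1$, $0<\tau<\beta$, $s\ge 1$, and let $u_0,u_1,u_2\in L^1(\mathbb{R}^N)\cap H^s(\mathbb{R}^N)$. Let $u$ be the solution of $$\tau u_{ttt}+u_{tt}-\Delta u-\beta\Delta u_t=0\quad\text{in }\mathbb{R}^N,\ t>0,$$ with $u(\cdot,0)=u_0$, $u_t(\cdot,0)=u_1$, $u_{tt}(\cdot,0)=u_2$. Fix $\nu_1>0$ sufficiently small (depending only on $\tau,\beta$) and set $$c=\min\left\{\frac1\beta,\ \frac{\beta-\tau}{2\beta\tau},\ |\operatorname{Re}\lambda_{2,3}(\nu_1)|\right\}>0.$$ Then there is a constant $C>0$, independent of $t$ and of the initial data, such that for all integers $0\le j\le s$ with $N+j\ge 3$ and all $t\ge 0$, $$\|\partial_x^ju(t)\|_{L^2}\le C\big(\|u_0\|_{L^1}+\|u_1\|_{L^1}+\|u_2\|_{L^1}\big)(1+t)^{-(N-2)/4-j/2}+C\big(\|\partial_x^ju_0\|_{L^2}+\|\partial_x^ju_1\|_{L^2}+\|\partial_x^ju_2\|_{L^2}\big)e^{-ct}.$$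
   Context: All norms are over $\mathbb{R}^N$. $\hat f(\xi)$ denotes the Fourier transform in $x\in\mathbb{R}^N$. $\partial_x^j$ stands for the spatial derivatives of order $j$, with (Plancherel) $\|\partial_x^jf\|_{L^2}^2=\int_{\mathbb{R}^N}|\xi|^{2j}|\hat f(\xi)|^2\,d\xi$. The solution $u$ is the one whose spatial Fourier transform solves, for each frequency $\xi$, the ODE $\tau\hat u_{ttt}+\hat u_{tt}+|\xi|^2\hat u+\beta|\xi|^2\hat u_t=0$ with $\hat u(\xi,0)=\hat u_0(\xi)$, $\hat u_t(\xi,0)=\hat u_1(\xi)$, $\hat u_{tt}(\xi,0)=\hat u_2(\xi)$. For $r=|\xi|$, the eigenvalues are the roots of $\tau\lambda^3+\lambda^2+\beta r^2\lambda+r^2=0$. For sufficiently small $r>0$ there are one real root and two nonreal complex conjugate roots; $\lambda_{2,3}(r)$ denotes this nonreal conjugate pair, whose real part is negative. *)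

theory Defs
  imports "HOL-Analysis.Analysis"
begin

text \<open>
  The dimension \<open>N\<close> has to be quantified after a smallness threshold that must not depend on it,
  so it cannot be a type index. Points of \<open>\<real>\<^sup>N\<close> are functions
  \<open>nat \<Rightarrow> real\<close> in the carrier of the \<open>N\<close>-fold product of Lebesgue measure.
  Functions on \<open>\<real>\<^sup>N\<close> are complex valued and only their values on that carrier matter;
  elements of \<open>L\<^sup>p\<close> are given by Borel representatives.
\<close>

abbreviation leb :: "nat \<Rightarrow> (nat \<Rightarrow> real) measure"
  where "leb N \<equiv> Pi\<^sub>M {..<N} (\<lambda>_. lborel)"

abbreviation vnorm :: "nat \<Rightarrow> (nat \<Rightarrow> real) \<Rightarrow> real"
  where "vnorm N x \<equiv> L2_set x {..<N}"

definition in_L1 :: "nat \<Rightarrow> ((nat \<Rightarrow> real) \<Rightarrow> complex) \<Rightarrow> bool"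
  where "in_L1 N f \<longleftrightarrow> integrable (leb N) f"

definition L1_norm :: "nat \<Rightarrow> ((nat \<Rightarrow> real) \<Rightarrow> complex) \<Rightarrow> real"
  where "L1_norm N f = (LINT x|leb N. cmod (f x))"

definition in_L2 :: "nat \<Rightarrow> ((nat \<Rightarrow> real) \<Rightarrow> complex) \<Rightarrow> bool"
  where "in_L2 N f \<longleftrightarrow>
    f \<in> borel_measurable (leb N) \<and> integrable (leb N) (\<lambda>x. (cmod (f x))\<^sup>2)"

definition L2_norm :: "nat \<Rightarrow> ((nat \<Rightarrow> real) \<Rightarrow> complex) \<Rightarrow> real"
  where "L2_norm N f = sqrt (LINT x|leb N. (cmod (f x))\<^sup>2)"

text \<open>
  The normalisation is the one for which the Laplacian has symbol \<open>-\<bar>\<xi>\<bar>\<^sup>2\<close> and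
  Plancherel's identity holds without a constant.
\<close>

definition fourier :: "nat \<Rightarrow> ((nat \<Rightarrow> real) \<Rightarrow> complex) \<Rightarrow> (nat \<Rightarrow> real) \<Rightarrow> complex"
  where "fourier N f \<xi> =
    complex_of_real ((2 * pi) powr (- real N / 2)) *
    (LINT x|leb N. exp (- \<i> * complex_of_real (\<Sum>i<N. x i * \<xi> i)) * f x)"

text \<open>
  \<open>g\<close> is a representative of the \<open>L\<^sup>2\<close> (Plancherel) Fourier transform of \<open>f\<close>, i.e. of
  the extension of \<^const>\<open>fourier\<close> by continuity from \<open>L\<^sup>1 \<inter> L\<^sup>2\<close> to \<open>L\<^sup>2\<close>.
\<close>

definition has_fourier_L2 ::
  "nat \<Rightarrow> ((nat \<Rightarrow> real) \<Rightarrow> complex) \<Rightarrow> ((nat \<Rightarrow> real) \<Rightarrow> complex) \<Rightarrow> bool"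
  where "has_fourier_L2 N f g \<longleftrightarrow> in_L2 N f \<and> in_L2 N g \<and>
    (\<exists>\<phi> :: nat \<Rightarrow> (nat \<Rightarrow> real) \<Rightarrow> complex.
      (\<forall>n. in_L1 N (\<phi> n) \<and> in_L2 N (\<phi> n) \<and> in_L2 N (fourier N (\<phi> n))) \<and>
      (\<lambda>n. L2_norm N (\<lambda>x. \<phi> n x - f x)) \<longlonglongrightarrow> 0 \<and>
      (\<lambda>n. L2_norm N (\<lambda>\<xi>. fourier N (\<phi> n) \<xi> - g \<xi>)) \<longlonglongrightarrow> 0)"

text \<open>The choice is unique up to null sets, so it does not affect the integrals below.\<close>

definition fourier_L2 :: "nat \<Rightarrow> ((nat \<Rightarrow> real) \<Rightarrow> complex) \<Rightarrow> (nat \<Rightarrow> real) \<Rightarrow> complex"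
  where "fourier_L2 N f = (SOME g. has_fourier_L2 N f g)"

definition in_Hs :: "nat \<Rightarrow> real \<Rightarrow> ((nat \<Rightarrow> real) \<Rightarrow> complex) \<Rightarrow> bool"
  where "in_Hs N s f \<longleftrightarrow> in_L2 N f \<and>
    integrable (leb N) (\<lambda>\<xi>. (1 + (vnorm N \<xi>)\<^sup>2) powr s * (cmod (fourier_L2 N f \<xi>))\<^sup>2)"

text \<open>
  \<open>\<parallel>\<partial>\<^sub>x\<^sup>j f\<parallel>\<close> in \<open>L\<^sup>2\<close>, in its Plancherel form. As the Bochner integral of a
  non-integrable function is \<open>0\<close>, this is meaningful only for \<open>f\<close> in \<open>H\<^sup>j\<close>.
\<close>

definition deriv_L2_norm :: "nat \<Rightarrow> nat \<Rightarrow> ((nat \<Rightarrow> real) \<Rightarrow> complex) \<Rightarrow> real"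
  where "deriv_L2_norm N j f =
    sqrt (LINT \<xi>|leb N. (vnorm N \<xi>) ^ (2 * j) * (cmod (fourier_L2 N f \<xi>))\<^sup>2)"

text \<open>
  \<open>y\<close> solves \<open>\<tau> y''' + y'' + r\<^sup>2 y + \<beta> r\<^sup>2 y' = 0\<close> on \<open>[0, \<infinity>)\<close> with
  \<open>y(0) = a0\<close>, \<open>y'(0) = a1\<close>, \<open>y''(0) = a2\<close>; the derivatives at \<open>0\<close> are one-sided.
\<close>

definition mgt_ode :: "real \<Rightarrow> real \<Rightarrow> real \<Rightarrow> complex \<Rightarrow> complex \<Rightarrow> complex \<Rightarrow> (real \<Rightarrow> complex) \<Rightarrow> bool"
  where "mgt_ode \<tau> \<beta> r a0 a1 a2 y \<longleftrightarrow>
    (\<exists>y1 y2 y3.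
      (\<forall>t\<ge>0. (y has_vector_derivative y1 t) (at t within {0..}) \<and>
              (y1 has_vector_derivative y2 t) (at t within {0..}) \<and>
              (y2 has_vector_derivative y3 t) (at t within {0..}) \<and>
              \<tau> *\<^sub>R y3 t + y2 t + r\<^sup>2 *\<^sub>R y t + (\<beta> * r\<^sup>2) *\<^sub>R y1 t = 0) \<and>
      y 0 = a0 \<and> y1 0 = a1 \<and> y2 0 = a2)"

text \<open>
  The data are in \<open>L\<^sup>1\<close>, so their transforms are given pointwise by the integral, whereas
  \<open>u t\<close> is only an \<open>L\<^sup>2\<close> function and its transform is the Plancherel one.
\<close>

definition mgt_solution ::
  "nat \<Rightarrow> real \<Rightarrow> real \<Rightarrow> ((nat \<Rightarrow> real) \<Rightarrow> complex) \<Rightarrow> ((nat \<Rightarrow> real) \<Rightarrow> complex) \<Rightarrow>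
   ((nat \<Rightarrow> real) \<Rightarrow> complex) \<Rightarrow> (real \<Rightarrow> (nat \<Rightarrow> real) \<Rightarrow> complex) \<Rightarrow> bool"
  where "mgt_solution N \<tau> \<beta> u0 u1 u2 u \<longleftrightarrow>
    (\<exists>U :: (nat \<Rightarrow> real) \<Rightarrow> real \<Rightarrow> complex.
      (\<forall>t\<ge>0. has_fourier_L2 N (u t) (\<lambda>\<xi>. U \<xi> t)) \<and>
      (\<forall>\<xi>\<in>space (leb N).
        mgt_ode \<tau> \<beta> (vnorm N \<xi>) (fourier N u0 \<xi>) (fourier N u1 \<xi>) (fourier N u2 \<xi>) (U \<xi>)))"

definition char_root :: "real \<Rightarrow> real \<Rightarrow> real \<Rightarrow> complex \<Rightarrow> bool"
  where "char_root \<tau> \<beta> r z \<longleftrightarrow>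
    complex_of_real \<tau> * z ^ 3 + z\<^sup>2 + complex_of_real (\<beta> * r\<^sup>2) * z + complex_of_real (r\<^sup>2) = 0"

text \<open>
  The member of the nonreal conjugate pair of eigenvalues in the upper half plane, defined where
  such a pair exists; the other member has the same real part.
\<close>

definition lambda2 :: "real \<Rightarrow> real \<Rightarrow> real \<Rightarrow> complex"
  where "lambda2 \<tau> \<beta> r = (THE z. char_root \<tau> \<beta> r z \<and> Im z > 0)"

definition decay_rate :: "real \<Rightarrow> real \<Rightarrow> real \<Rightarrow> real"
  where "decay_rate \<tau> \<beta> \<nu> =
    Min {1 / \<beta>, (\<beta> - \<tau>) / (2 * \<beta> * \<tau>), \<bar>Re (lambda2 \<tau> \<beta> \<nu>)\<bar>}"

end

theory Submission
  imports Defs "HOL-Probability.Characteristic_Functions"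
begin

text \<open>
  On the Fourier side the equation decouples into one linear ODE for each frequency \<open>\<xi>\<close>, whose
  coefficients depend only on \<open>r = |\<xi>|\<close>. A Lyapunov functional, an energy with a small cross term,
  controls all frequencies at once (\<open>mode_decay_exists\<close>):
  \<open>r\<^sup>2 |U \<xi> t|\<^sup>2 \<le> C max 1 r\<^sup>2 exp (- \<kappa> t min 1 r\<^sup>2)\<close> times the squared size of the transformed data.

  The two terms of the estimate come from splitting the frequencies at \<open>r = 1\<close>
  (\<open>frequency_split_bound\<close>). For \<open>r \<ge> 1\<close> the factor \<open>exp (- \<kappa> t)\<close> is uniform and multiplies the weighted
  \<open>L\<^sup>2\<close> norm of the data. For \<open>r \<le> 1\<close> the transformed data are bounded by \<open>L\<^sup>1\<close> norms, and there
  remains the integral of \<open>r ^ (2 * j) exp (- \<kappa> r\<^sup>2 T) / r\<^sup>2\<close> with \<open>T = 1 + t\<close>. By scaling it is of order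
  \<open>T powr (- (N - 2) / 2 - j)\<close>, the division by \<open>r\<^sup>2\<close> costing two dimensions; it converges at
  \<open>r = 0\<close> because \<open>N + 2 j > 2\<close> (\<open>heat_weight_decay_exists\<close>).

  The rate \<open>decay_rate \<tau> \<beta> \<nu>\<close> enters through its size only. As \<open>\<nu>\<close> tends to 0 the nonreal eigenvalues
  approach the imaginary axis from the left, with real part of order \<open>\<nu>\<^sup>2\<close>, so for small \<open>\<nu>\<close> the rate is
  positive and below \<open>\<kappa> / 2\<close> (\<open>decay_rate_small\<close>).

  The derivative norms are defined by the \<open>L\<^sup>2\<close> transform, whereas the initial values of the ODEs are
  Fourier integrals. The two agree almost everywhere because the Fourier integral is a contraction in
  \<open>L\<^sup>2\<close> on \<open>L\<^sup>1 \<inter> L\<^sup>2\<close>; this half of Plancherel's theorem (\<open>plancherel_le\<close>) follows by damping with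
  Gaussians.
\<close>

section \<open>Energy decay of a single Fourier mode\<close>

text \<open>
  With \<open>v = y + \<tau> y'\<close>, \<open>w = v'\<close>, \<open>z = y'\<close> and \<open>k = \<beta> - \<tau>\<close>, the third-order equation becomes
  \<open>w' = - r\<^sup>2 v - k r\<^sup>2 z\<close>: an oscillator for \<open>v\<close> forced by \<open>z\<close>, coupled to \<open>\<tau> z' = w - z\<close>. The
  weight \<open>\<tau> k r\<^sup>2\<close> on \<open>z\<close> makes the cross terms cancel in the derivative, which is
  \<open>- 2 k r\<^sup>2 |z|\<^sup>2\<close>.
\<close>

definition energy :: "real \<Rightarrow> real \<Rightarrow> real \<Rightarrow> complex \<Rightarrow> complex \<Rightarrow> complex \<Rightarrow> real"
  where "energy \<tau> k r v w z = w \<bullet> w + r\<^sup>2 * (v \<bullet> v) + \<tau> * k * r\<^sup>2 * (z \<bullet> z)"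

text \<open>
  The energy dissipates only \<open>z\<close>. The derivative of \<open>v \<bullet> w\<close> produces \<open>- r\<^sup>2 |v|\<^sup>2\<close> at the cost of
  \<open>|w|\<^sup>2\<close>, and that of \<open>- \<tau> (z \<bullet> w)\<close> produces \<open>- |w|\<^sup>2\<close>; the factor 2 leaves a net loss of \<open>|w|\<^sup>2\<close>.
\<close>

definition corrector :: "real \<Rightarrow> complex \<Rightarrow> complex \<Rightarrow> complex \<Rightarrow> real"
  where "corrector \<tau> v w z = v \<bullet> w - 2 * \<tau> * (z \<bullet> w)"

lemma young_inner: "2 * \<bar>x \<bullet> y\<bar> \<le> (x \<bullet> x) + (y \<bullet> (y :: 'a::real_inner))"
proof -
  have "0 \<le> (x - y) \<bullet> (x - y)" "0 \<le> (x + y) \<bullet> (x + y)" by simp_all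
  then show ?thesis
    by (simp add: inner_diff_left inner_diff_right inner_add_left inner_add_right inner_commute
        abs_if)
qed

text \<open>
  The weight \<open>\<rho>\<close> has to be at most \<open>|r| / 2\<close>, because the products \<open>v \<bullet> w\<close> and \<open>z \<bullet> w\<close> are
  controlled by the energy only after multiplication by \<open>|r|\<close>. Hence a small multiple of the weighted
  corrector changes the energy by a bounded factor, uniformly in \<open>r\<close>.
\<close>

lemma corrector_le_energy:
  fixes \<tau> k r :: real and v w z :: complex
  assumes "0 < \<tau>" "0 < k"
  defines "\<rho> \<equiv> r\<^sup>2 / (1 + r\<^sup>2)"
  shows "\<bar>\<rho> * corrector \<tau> v w z\<bar> \<le> (1 / (2 * k) + \<tau> / 2 + 1 / 4) * energy \<tau> k r v w z"
proof -
  have pos: "1 + r\<^sup>2 > 0" by (simp add: add_pos_nonneg)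
  have rho: "0 \<le> \<rho>" "\<rho> \<le> \<bar>r\<bar> / 2"
  proof -
    show "0 \<le> \<rho>" unfolding \<rho>_def by simp
    have "0 \<le> \<bar>r\<bar> * (\<bar>r\<bar> - 1)\<^sup>2" by simp
    also have "\<dots> = \<bar>r\<bar> * (1 + r\<^sup>2) - 2 * r\<^sup>2"
      by (simp add: power2_eq_square algebra_simps)
    finally show "\<rho> \<le> \<bar>r\<bar> / 2"
      unfolding \<rho>_def using pos by (simp add: divide_simps)
  qed
  have r_young: "\<bar>r\<bar> * \<bar>x \<bullet> w\<bar> \<le> (r\<^sup>2 * (x \<bullet> x) + w \<bullet> w) / 2" for x :: complex
    using young_inner[of "r *\<^sub>R x" w] by (simp add: abs_mult power2_eq_square mult.assoc)
  have "\<bar>\<rho> * corrector \<tau> v w z\<bar> \<le> \<rho> * (\<bar>v \<bullet> w\<bar> + 2 * \<tau> * \<bar>z \<bullet> w\<bar>)"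
    unfolding corrector_def abs_mult using rho(1) assms(1)
    by (intro mult_mono order_trans[OF abs_triangle_ineq4]) (auto simp: abs_mult)
  also have "\<dots> \<le> \<bar>r\<bar> / 2 * (\<bar>v \<bullet> w\<bar> + 2 * \<tau> * \<bar>z \<bullet> w\<bar>)"
    using rho assms(1) by (intro mult_right_mono) auto
  also have "\<dots> = (\<bar>r\<bar> * \<bar>v \<bullet> w\<bar>) / 2 + \<tau> * (\<bar>r\<bar> * \<bar>z \<bullet> w\<bar>)"
    by (simp add: algebra_simps)
  also have "\<dots> \<le> (r\<^sup>2 * (v \<bullet> v) + w \<bullet> w) / 2 / 2 + \<tau> * ((r\<^sup>2 * (z \<bullet> z) + w \<bullet> w) / 2)"
    using r_young[of v] r_young[of z] assms(1) by (intro add_mono mult_left_mono) auto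
  also have "\<dots> \<le> (1 / (2 * k) + \<tau> / 2 + 1 / 4) * energy \<tau> k r v w z"
  proof -
    have "(1 / (2 * k) + \<tau> / 2 + 1 / 4) * energy \<tau> k r v w z
        - ((r\<^sup>2 * (v \<bullet> v) + w \<bullet> w) / 2 / 2 + \<tau> * ((r\<^sup>2 * (z \<bullet> z) + w \<bullet> w) / 2))
      = 1 / (2 * k) * (w \<bullet> w + r\<^sup>2 * (v \<bullet> v)) + \<tau> / 2 * (r\<^sup>2 * (v \<bullet> v))
        + (\<tau> / 2 + 1 / 4) * (\<tau> * k * r\<^sup>2 * (z \<bullet> z))"
      using assms(2) by (simp add: energy_def field_simps)
    also have "\<dots> \<ge> 0" using assms(1,2) by simp
    finally show ?thesis by simp
  qed
  finally show ?thesis .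
qed

text \<open>
  The left-hand side is \<open>\<rho>\<close> times the derivative of the corrector along a solution. The remainder in
  \<open>|z|\<^sup>2\<close> carries the factor \<open>r\<^sup>2\<close> because \<open>\<rho> \<le> r\<^sup>2\<close>, so that the dissipation of the energy can
  absorb it.
\<close>

lemma corrector_dissipation:
  fixes \<tau> k r :: real and v w z :: complex
  assumes "0 < \<tau>" "0 < k"
  defines "\<rho> \<equiv> r\<^sup>2 / (1 + r\<^sup>2)"
  shows "\<rho> * (w \<bullet> w + v \<bullet> (- r\<^sup>2 *\<^sub>R v - (k * r\<^sup>2) *\<^sub>R z)
      - 2 * ((w - z) \<bullet> w + \<tau> * (z \<bullet> (- r\<^sup>2 *\<^sub>R v - (k * r\<^sup>2) *\<^sub>R z))))
    \<le> - (\<rho> / 2) * (w \<bullet> w + r\<^sup>2 * (v \<bullet> v))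
      + (2 + (2 * \<tau> - k)\<^sup>2 / 2 + 2 * \<tau> * k) * (r\<^sup>2 * (z \<bullet> z))"
    (is "\<rho> * ?F \<le> _")
proof -
  have pos: "1 + r\<^sup>2 > 0" by (simp add: add_pos_nonneg)
  have rho: "0 \<le> \<rho>" "\<rho> \<le> r\<^sup>2" "\<rho> \<le> 1"
    unfolding \<rho>_def using pos by (auto simp: divide_simps algebra_simps)
  let ?m = "2 * \<tau> - k"
  have y1: "2 * (z \<bullet> w) \<le> 2 * (z \<bullet> z) + (w \<bullet> w) / 2"
    using young_inner[of "2 *\<^sub>R z" w] by simp
  have y2: "?m * (z \<bullet> v) \<le> (v \<bullet> v) / 2 + ?m\<^sup>2 / 2 * (z \<bullet> z)"
    using young_inner[of "?m *\<^sub>R z" v] by (simp add: power2_eq_square)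
  have "?F = - (w \<bullet> w) - r\<^sup>2 * (v \<bullet> v) + 2 * (z \<bullet> w) + r\<^sup>2 * (?m * (z \<bullet> v))
      + 2 * \<tau> * k * (r\<^sup>2 * (z \<bullet> z))"
    by (simp add: inner_diff_left inner_diff_right inner_commute algebra_simps)
  also have "\<dots> \<le> - (w \<bullet> w) - r\<^sup>2 * (v \<bullet> v) + (2 * (z \<bullet> z) + (w \<bullet> w) / 2)
      + r\<^sup>2 * ((v \<bullet> v) / 2 + ?m\<^sup>2 / 2 * (z \<bullet> z)) + 2 * \<tau> * k * (r\<^sup>2 * (z \<bullet> z))"
    using y1 y2 by (intro add_mono mult_left_mono order_refl) auto
  also have "\<dots> = - (1 / 2) * (w \<bullet> w + r\<^sup>2 * (v \<bullet> v))
      + (2 * (z \<bullet> z) + (?m\<^sup>2 / 2 + 2 * \<tau> * k) * (r\<^sup>2 * (z \<bullet> z)))"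
    by (simp add: algebra_simps)
  finally have "\<rho> * ?F \<le> \<rho> * \<dots>" using rho(1) by (rule mult_left_mono)
  also have "\<dots> = - (\<rho> / 2) * (w \<bullet> w + r\<^sup>2 * (v \<bullet> v))
      + (2 * (\<rho> * (z \<bullet> z)) + (?m\<^sup>2 / 2 + 2 * \<tau> * k) * (\<rho> * (r\<^sup>2 * (z \<bullet> z))))"
    by (simp add: algebra_simps)
  also have "\<dots> \<le> - (\<rho> / 2) * (w \<bullet> w + r\<^sup>2 * (v \<bullet> v))
      + (2 * (r\<^sup>2 * (z \<bullet> z)) + (?m\<^sup>2 / 2 + 2 * \<tau> * k) * (r\<^sup>2 * (z \<bullet> z)))"
    using rho assms(1,2)
    by (intro add_mono mult_left_mono order_refl mult_right_mono mult_left_le_one_le) auto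
  finally show ?thesis by (simp add: algebra_simps)
qed

lemma gronwall_decay:
  fixes L :: "real \<Rightarrow> real"
  assumes der: "\<And>s. 0 \<le> s \<Longrightarrow> (L has_real_derivative L' s) (at s within {0..})"
    and le: "\<And>s. 0 \<le> s \<Longrightarrow> L' s \<le> - c * L s" and "0 \<le> t"
  shows "L t \<le> exp (- c * t) * L 0"
proof -
  define g where "g = (\<lambda>s. exp (c * s) * L s)"
  have g': "(g has_real_derivative exp (c * s) * (c * L s + L' s)) (at s within {0..})"
    if "0 \<le> s" for s
    unfolding g_def by (rule derivative_eq_intros der that refl | simp add: algebra_simps)+
  have "g t \<le> g 0"
  proof (rule DERIV_nonpos_imp_decreasing_open[OF \<open>0 \<le> t\<close>])
    fix s assume s: "0 < s" "s < t"
    have "at s within {0..} = at s" using s by (intro at_within_interior) auto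
    with g'[of s] s have "DERIV g s :> exp (c * s) * (c * L s + L' s)" by simp
    moreover have "exp (c * s) * (c * L s + L' s) \<le> 0"
      using le[of s] s by (simp add: mult_le_0_iff)
    ultimately show "\<exists>y. DERIV g s :> y \<and> y \<le> 0" by blast
    next
    show "continuous_on {0..t} g"
      by (rule continuous_on_subset[OF DERIV_continuous_on[of "{0..}"]]) (auto intro: g')
  qed
  then have "exp (c * t) * L t \<le> L 0" by (simp add: g_def)
  then have "exp (- c * t) * (exp (c * t) * L t) \<le> exp (- c * t) * L 0"
    by (intro mult_left_mono) auto
  then show ?thesis by (simp add: mult.assoc[symmetric] exp_add[symmetric])
qed

lemma has_real_derivative_inner:
  fixes f g :: "real \<Rightarrow> 'a::real_inner"
  assumes "(f has_vector_derivative f') (at x within S)" "(g has_vector_derivative g') (at x within S)"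
  shows "((\<lambda>x. f x \<bullet> g x) has_real_derivative (f x \<bullet> g' + f' \<bullet> g x)) (at x within S)"
  using bounded_bilinear.has_vector_derivative[OF bounded_bilinear_inner assms]
  by (simp add: has_real_derivative_iff_has_vector_derivative)

text \<open>
  The functional \<open>L = E + \<epsilon> \<rho> F\<close>, with \<open>F\<close> the corrector, lies between half and twice the energy \<open>E\<close>
  and satisfies \<open>L' \<le> - c \<rho> L\<close> once \<open>\<epsilon>\<close> is small. The rate \<open>\<rho> = r\<^sup>2 / (1 + r\<^sup>2)\<close> is of heat type
  for small \<open>r\<close> and bounded below for large \<open>r\<close>.
\<close>

lemma energy_decay:
  fixes \<tau> k :: real
  assumes "0 < \<tau>" "0 < k"
  obtains c where "0 < c"
    "\<And>r v w z t. (\<And>s. 0 \<le> s \<Longrightarrow> (v has_vector_derivative w s) (at s within {0..})) \<Longrightarrow>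
      (\<And>s. 0 \<le> s \<Longrightarrow> (w has_vector_derivative (- r\<^sup>2 *\<^sub>R v s - (k * r\<^sup>2) *\<^sub>R z s)) (at s within {0..})) \<Longrightarrow>
      (\<And>s. 0 \<le> s \<Longrightarrow> (z has_vector_derivative (inverse \<tau> *\<^sub>R (w s - z s))) (at s within {0..})) \<Longrightarrow>
      0 \<le> t \<Longrightarrow>
      energy \<tau> k r (v t) (w t) (z t)
        \<le> 3 * exp (- c * (r\<^sup>2 / (1 + r\<^sup>2)) * t) * energy \<tau> k r (v 0) (w 0) (z 0)"
proof -
  define K where "K = 1 / (2 * k) + \<tau> / 2 + 1 / 4"
  define M where "M = 2 + (2 * \<tau> - k)\<^sup>2 / 2 + 2 * \<tau> * k"
  \<comment> \<open>\<open>\<epsilon> M \<le> k\<close> lets the energy absorb the remainder of the corrector; \<open>\<epsilon> K \<le> 1/2\<close> keeps \<open>L\<close> comparable to the energy.\<close>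
  define \<epsilon> where "\<epsilon> = min (k / M) (1 / (2 * K))"
  define c0 where "c0 = min (1 / \<tau>) (\<epsilon> / 2)"
  have K: "K > 0" using assms unfolding K_def by (intro add_pos_pos) auto
  have M: "M > 0" using assms unfolding M_def by (intro add_pos_pos add_pos_nonneg) auto
  have eps: "0 < \<epsilon>" "\<epsilon> * M \<le> k" "\<epsilon> * K \<le> 1 / 2"
  proof -
    show "0 < \<epsilon>" using K M assms by (simp add: \<epsilon>_def)
    have "\<epsilon> * M \<le> k / M * M" using M by (intro mult_right_mono) (auto simp: \<epsilon>_def)
    then show "\<epsilon> * M \<le> k" using M by simp
    have "\<epsilon> * K \<le> 1 / (2 * K) * K" using K by (intro mult_right_mono) (auto simp: \<epsilon>_def)
    then show "\<epsilon> * K \<le> 1 / 2" using K by simp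
  qed
  have c0: "0 < c0" "c0 * \<tau> \<le> 1" "c0 \<le> \<epsilon> / 2"
  proof -
    show "0 < c0" "c0 \<le> \<epsilon> / 2" using eps assms by (simp_all add: c0_def)
    have "c0 * \<tau> \<le> 1 / \<tau> * \<tau>" using assms by (intro mult_right_mono) (auto simp: c0_def)
    then show "c0 * \<tau> \<le> 1" using assms by simp
  qed
  show ?thesis
  proof (rule that[of "c0 / 2"])
    show "0 < c0 / 2" using c0 by simp
    fix r t :: real and v w z :: "real \<Rightarrow> complex"
    assume dv: "\<And>s. 0 \<le> s \<Longrightarrow> (v has_vector_derivative w s) (at s within {0..})"
      and dw: "\<And>s. 0 \<le> s \<Longrightarrow> (w has_vector_derivative (- r\<^sup>2 *\<^sub>R v s - (k * r\<^sup>2) *\<^sub>R z s)) (at s within {0..})"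
      and dz: "\<And>s. 0 \<le> s \<Longrightarrow> (z has_vector_derivative (inverse \<tau> *\<^sub>R (w s - z s))) (at s within {0..})"
      and t: "0 \<le> t"
    define \<rho> where "\<rho> = r\<^sup>2 / (1 + r\<^sup>2)"
    define E where "E s = energy \<tau> k r (v s) (w s) (z s)" for s
    define F where "F s = corrector \<tau> (v s) (w s) (z s)" for s
    define F' where "F' s = w s \<bullet> w s + v s \<bullet> (- r\<^sup>2 *\<^sub>R v s - (k * r\<^sup>2) *\<^sub>R z s)
      - 2 * ((w s - z s) \<bullet> w s + \<tau> * (z s \<bullet> (- r\<^sup>2 *\<^sub>R v s - (k * r\<^sup>2) *\<^sub>R z s)))" for s
    define L where "L s = E s + \<epsilon> * (\<rho> * F s)" for s
    have pos: "1 + r\<^sup>2 > 0" by (simp add: add_pos_nonneg)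
    have rho: "0 \<le> \<rho>" "\<rho> \<le> 1"
      unfolding \<rho>_def using pos by (auto simp: divide_simps)
    have E0: "0 \<le> E s" for s using assms by (simp add: E_def energy_def)
    have dE: "(E has_real_derivative - 2 * k * (r\<^sup>2 * (z s \<bullet> z s))) (at s within {0..})"
      if s: "0 \<le> s" for s
      unfolding E_def energy_def
      by (rule derivative_eq_intros has_real_derivative_inner dv dw dz s refl)+
        (use assms in \<open>simp add: inner_diff_left inner_diff_right inner_commute field_simps\<close>)
    have dF: "(F has_real_derivative F' s) (at s within {0..})" if s: "0 \<le> s" for s
      unfolding F_def corrector_def
      by (rule derivative_eq_intros has_real_derivative_inner dv dw dz s refl)+
        (use assms in \<open>simp add: F'_def inner_diff_left inner_diff_right inner_commute field_simps\<close>)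
    have dL: "(L has_real_derivative - 2 * k * (r\<^sup>2 * (z s \<bullet> z s)) + \<epsilon> * (\<rho> * F' s)) (at s within {0..})"
      if s: "0 \<le> s" for s
      unfolding L_def by (rule derivative_eq_intros dE dF s refl | simp)+
    have FE: "\<bar>\<epsilon> * (\<rho> * F s)\<bar> \<le> E s / 2" for s
    proof -
      have "\<bar>\<epsilon> * (\<rho> * F s)\<bar> \<le> \<epsilon> * (K * E s)"
        using mult_left_mono[OF corrector_le_energy[OF assms, of r "v s" "w s" "z s"], of \<epsilon>] eps(1)
        by (simp only: abs_mult[of \<epsilon>] F_def E_def \<rho>_def K_def abs_of_pos less_imp_le)
      also have "\<dots> \<le> 1 / 2 * E s" using mult_right_mono[OF eps(3) E0[of s]] by (simp add: mult.assoc)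
      finally show ?thesis by simp
    qed
    have L_le: "L s \<le> 3 / 2 * E s" and L_ge: "E s / 2 \<le> L s" for s
      using FE[of s] by (auto simp: L_def abs_le_iff)
    have diss: "- 2 * k * (r\<^sup>2 * (z s \<bullet> z s)) + \<epsilon> * (\<rho> * F' s) \<le> - (c0 / 2 * \<rho>) * L s" for s
    proof -
      let ?zz = "r\<^sup>2 * (z s \<bullet> z s)" and ?vw = "w s \<bullet> w s + r\<^sup>2 * (v s \<bullet> v s)"
      have "\<epsilon> * (\<rho> * F' s) \<le> \<epsilon> * (- (\<rho> / 2) * ?vw + M * ?zz)"
        using corrector_dissipation[OF assms, of r "w s" "v s" "z s"] eps(1)
        by (intro mult_left_mono) (auto simp: F'_def \<rho>_def M_def)
      also have "\<dots> = - (\<epsilon> / 2) * (\<rho> * ?vw) + (\<epsilon> * M) * ?zz" by (simp add: algebra_simps)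
      also have "\<dots> \<le> - c0 * (\<rho> * ?vw) + k * ?zz"
        using c0 eps rho by (intro add_mono mult_right_mono) auto
      finally have "- 2 * k * ?zz + \<epsilon> * (\<rho> * F' s) \<le> - c0 * (\<rho> * ?vw) - k * ?zz"
        by (simp add: algebra_simps)
      also have "\<dots> \<le> - c0 * (\<rho> * ?vw) - c0 * \<tau> * \<rho> * (k * ?zz)"
      proof -
        have "c0 * \<tau> * \<rho> \<le> 1 * 1" using c0 rho assms by (intro mult_mono) auto
        then have "c0 * \<tau> * \<rho> * (k * ?zz) \<le> 1 * (k * ?zz)" using assms by (intro mult_right_mono) auto
        then show ?thesis by simp
      qed
      also have "\<dots> = - c0 * \<rho> * E s" by (simp add: E_def energy_def algebra_simps)
      also have "\<dots> \<le> - (c0 / 2 * \<rho>) * L s"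
      proof -
        have "L s / 2 \<le> E s" using L_le[of s] E0[of s] by simp
        then have "c0 * \<rho> * (L s / 2) \<le> c0 * \<rho> * E s" using c0 rho by (intro mult_left_mono) auto
        then show ?thesis by simp
      qed
      finally show ?thesis .
    qed
    have "L t \<le> exp (- (c0 / 2 * \<rho>) * t) * L 0"
      by (rule gronwall_decay[OF dL diss t])
    also have "\<dots> \<le> exp (- (c0 / 2 * \<rho>) * t) * (3 / 2 * E 0)"
      using L_le[of 0] by (intro mult_left_mono) auto
    finally have "E t \<le> 3 * exp (- (c0 / 2 * \<rho>) * t) * E 0" using L_ge[of t] by simp
    then show "energy \<tau> k r (v t) (w t) (z t)
        \<le> 3 * exp (- (c0 / 2) * (r\<^sup>2 / (1 + r\<^sup>2)) * t) * energy \<tau> k r (v 0) (w 0) (z 0)"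
      by (simp add: E_def \<rho>_def)
  qed
qed

lemma min_one_le_frac: "min 1 (r\<^sup>2) / 2 \<le> r\<^sup>2 / (1 + (r::real)\<^sup>2)"
proof -
  have pos: "1 + r\<^sup>2 > 0" by (simp add: add_pos_nonneg)
  have "min 1 (r\<^sup>2) * (1 + r\<^sup>2) \<le> 2 * r\<^sup>2"
  proof (cases "r\<^sup>2 \<le> 1")
    case True
    then show ?thesis using mult_left_mono[OF True, of "r\<^sup>2"] by (simp add: min_def algebra_simps)
  qed (simp add: min_def)
  then show ?thesis using pos by (simp add: field_simps)
qed

text \<open>
  The factor \<open>r\<^sup>2\<close> on the left is the price of recovering \<open>y\<close> from the energy, in which it enters only as
  \<open>r\<^sup>2 |y + \<tau> y'|\<^sup>2\<close>. It is harmless for \<open>r \<ge> 1\<close>, where it cancels against the maximum, and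
  is a loss of \<open>1 / r\<^sup>2\<close> at low frequencies.
\<close>

definition mode_decay :: "real \<Rightarrow> real \<Rightarrow> real \<Rightarrow> real \<Rightarrow> bool"
  where "mode_decay \<tau> \<beta> \<kappa> C \<longleftrightarrow> (\<forall>r a0 a1 a2 y t. mgt_ode \<tau> \<beta> r a0 a1 a2 y \<and> 0 \<le> t \<longrightarrow>
    r\<^sup>2 * (cmod (y t))\<^sup>2 \<le> C * max 1 (r\<^sup>2) * exp (- \<kappa> * min 1 (r\<^sup>2) * t)
      * ((cmod a0)\<^sup>2 + (cmod a1)\<^sup>2 + (cmod a2)\<^sup>2))"

text \<open>
  Since \<open>y = v - \<tau> z\<close>, the energy at time \<open>t\<close> dominates \<open>r\<^sup>2 |y|\<^sup>2\<close>, and the energy at time 0 is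
  at most a multiple of \<open>max 1 r\<^sup>2\<close> times the size of the data.
\<close>

lemma mode_decay_exists:
  fixes \<tau> \<beta> :: real
  assumes "0 < \<tau>" "\<tau> < \<beta>"
  obtains \<kappa> C where "0 < \<kappa>" "0 < C" "mode_decay \<tau> \<beta> \<kappa> C"
proof -
  define k where "k = \<beta> - \<tau>"
  have k: "0 < k" using assms by (simp add: k_def)
  obtain c where c: "0 < c" and decay:
    "\<And>r v w z t. (\<And>s. 0 \<le> s \<Longrightarrow> (v has_vector_derivative w s) (at s within {0..})) \<Longrightarrow>
      (\<And>s. 0 \<le> s \<Longrightarrow> (w has_vector_derivative (- r\<^sup>2 *\<^sub>R v s - (k * r\<^sup>2) *\<^sub>R z s)) (at s within {0..})) \<Longrightarrow>
      (\<And>s. 0 \<le> s \<Longrightarrow> (z has_vector_derivative (inverse \<tau> *\<^sub>R (w s - z s))) (at s within {0..})) \<Longrightarrow>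
      0 \<le> t \<Longrightarrow>
      energy \<tau> k r (v t) (w t) (z t)
        \<le> 3 * exp (- c * (r\<^sup>2 / (1 + r\<^sup>2)) * t) * energy \<tau> k r (v 0) (w 0) (z 0)"
    using energy_decay[OF assms(1) k] by blast
  define C1 where "C1 = 2 + 2 * \<tau> / k"
  define C2 where "C2 = 4 + 4 * \<tau>\<^sup>2 + \<tau> * k"
  have C1: "0 < C1" using assms k by (auto simp: C1_def intro: add_pos_pos)
  have C2: "0 < C2" using assms k by (auto simp: C2_def intro!: add_pos_pos)
  show ?thesis
  proof (rule that[of "c / 2" "C1 * 3 * C2"])
    show "0 < c / 2" "0 < C1 * 3 * C2" using c C1 C2 by auto
    show "mode_decay \<tau> \<beta> (c / 2) (C1 * 3 * C2)" unfolding mode_decay_def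
    proof (intro allI impI, elim conjE)
      fix r t :: real and a0 a1 a2 y
      assume ode: "mgt_ode \<tau> \<beta> r a0 a1 a2 y" and t: "0 \<le> t"
      from ode obtain y1 y2 y3 where
        dy: "\<And>t. 0 \<le> t \<Longrightarrow> (y has_vector_derivative y1 t) (at t within {0..})" and
        dy1: "\<And>t. 0 \<le> t \<Longrightarrow> (y1 has_vector_derivative y2 t) (at t within {0..})" and
        dy2: "\<And>t. 0 \<le> t \<Longrightarrow> (y2 has_vector_derivative y3 t) (at t within {0..})" and
        eq: "\<And>t. 0 \<le> t \<Longrightarrow> \<tau> *\<^sub>R y3 t + y2 t + r\<^sup>2 *\<^sub>R y t + (\<beta> * r\<^sup>2) *\<^sub>R y1 t = 0" and
        init: "y 0 = a0" "y1 0 = a1" "y2 0 = a2"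
        unfolding mgt_ode_def by blast
      define v where "v s = y s + \<tau> *\<^sub>R y1 s" for s
      define w where "w s = y1 s + \<tau> *\<^sub>R y2 s" for s
      have dv: "(v has_vector_derivative w s) (at s within {0..})" if "0 \<le> s" for s
        unfolding v_def w_def by (auto intro!: derivative_eq_intros dy dy1 that)
      have dw: "(w has_vector_derivative (- r\<^sup>2 *\<^sub>R v s - (k * r\<^sup>2) *\<^sub>R y1 s)) (at s within {0..})"
        if "0 \<le> s" for s
      proof -
        have "(w has_vector_derivative (y2 s + \<tau> *\<^sub>R y3 s)) (at s within {0..})"
          unfolding w_def by (auto intro!: derivative_eq_intros dy1 dy2 that)
        moreover have "y2 s + \<tau> *\<^sub>R y3 s = - r\<^sup>2 *\<^sub>R v s - (k * r\<^sup>2) *\<^sub>R y1 s"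
        proof -
          have "y2 s + \<tau> *\<^sub>R y3 s = (\<tau> *\<^sub>R y3 s + y2 s + r\<^sup>2 *\<^sub>R y s + (\<beta> * r\<^sup>2) *\<^sub>R y1 s)
              - r\<^sup>2 *\<^sub>R y s - (\<beta> * r\<^sup>2) *\<^sub>R y1 s" by simp
          also have "\<dots> = - r\<^sup>2 *\<^sub>R y s - (\<beta> * r\<^sup>2) *\<^sub>R y1 s" using eq[OF that] by simp
          also have "\<dots> = - r\<^sup>2 *\<^sub>R v s - (k * r\<^sup>2) *\<^sub>R y1 s"
            by (simp add: v_def k_def algebra_simps)
          finally show ?thesis .
        qed
        ultimately show ?thesis by simp
      qed
      have dz: "(y1 has_vector_derivative (inverse \<tau> *\<^sub>R (w s - y1 s))) (at s within {0..})"
        if "0 \<le> s" for s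
        using dy1[OF that] assms(1) by (simp add: w_def)
      let ?D = "(cmod a0)\<^sup>2 + (cmod a1)\<^sup>2 + (cmod a2)\<^sup>2"
      have sq_add: "(cmod (x + e *\<^sub>R x'))\<^sup>2 \<le> 2 * (cmod x)\<^sup>2 + 2 * e\<^sup>2 * (cmod x')\<^sup>2" for e x x'
        using young_inner[of x "e *\<^sub>R x'"] unfolding power2_norm_eq_inner
        by (simp add: inner_add_left inner_add_right inner_commute power2_eq_square[of e] abs_le_iff)
      have E0: "energy \<tau> k r (v 0) (w 0) (y1 0) \<le> C2 * (max 1 (r\<^sup>2) * ?D)"
      proof -
        let ?m = "max 1 (r\<^sup>2)"
        have "energy \<tau> k r (v 0) (w 0) (y1 0)
            = (cmod (w 0))\<^sup>2 + r\<^sup>2 * (cmod (v 0))\<^sup>2 + \<tau> * k * r\<^sup>2 * (cmod a1)\<^sup>2"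
          by (simp add: energy_def power2_norm_eq_inner init)
        also have "\<dots> \<le> ?m * (cmod (w 0))\<^sup>2 + ?m * (cmod (v 0))\<^sup>2 + ?m * (\<tau> * k * (cmod a1)\<^sup>2)"
        proof -
          have "1 * (cmod (w 0))\<^sup>2 \<le> ?m * (cmod (w 0))\<^sup>2" by (intro mult_right_mono) auto
          moreover have "r\<^sup>2 * (cmod (v 0))\<^sup>2 \<le> ?m * (cmod (v 0))\<^sup>2" by (intro mult_right_mono) auto
          moreover have "r\<^sup>2 * (\<tau> * k * (cmod a1)\<^sup>2) \<le> ?m * (\<tau> * k * (cmod a1)\<^sup>2)"
            using assms k by (intro mult_right_mono) auto
          ultimately show ?thesis by (simp add: algebra_simps)
        qed
        also have "\<dots> = ?m * ((cmod (w 0))\<^sup>2 + (cmod (v 0))\<^sup>2 + \<tau> * k * (cmod a1)\<^sup>2)"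
          by (simp add: algebra_simps)
        also have "\<dots> \<le> ?m * (C2 * ?D)"
        proof (intro mult_left_mono)
          have "(cmod (w 0))\<^sup>2 + (cmod (v 0))\<^sup>2 + \<tau> * k * (cmod a1)\<^sup>2
            \<le> (2 * (cmod a1)\<^sup>2 + 2 * \<tau>\<^sup>2 * (cmod a2)\<^sup>2) + (2 * (cmod a0)\<^sup>2 + 2 * \<tau>\<^sup>2 * (cmod a1)\<^sup>2)
              + \<tau> * k * (cmod a1)\<^sup>2"
            unfolding w_def v_def init by (intro add_mono sq_add order_refl)
          also have "\<dots> \<le> C2 * ?D"
          proof -
            have "C2 * ?D - ((2 * (cmod a1)\<^sup>2 + 2 * \<tau>\<^sup>2 * (cmod a2)\<^sup>2)
                + (2 * (cmod a0)\<^sup>2 + 2 * \<tau>\<^sup>2 * (cmod a1)\<^sup>2) + \<tau> * k * (cmod a1)\<^sup>2)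
              = (2 + 4 * \<tau>\<^sup>2 + \<tau> * k) * (cmod a0)\<^sup>2 + (2 + 2 * \<tau>\<^sup>2) * (cmod a1)\<^sup>2
                + (4 + 2 * \<tau>\<^sup>2 + \<tau> * k) * (cmod a2)\<^sup>2"
              by (simp add: C2_def algebra_simps)
            also have "\<dots> \<ge> 0" using assms k by simp
            finally show ?thesis by simp
          qed
          finally show "(cmod (w 0))\<^sup>2 + (cmod (v 0))\<^sup>2 + \<tau> * k * (cmod a1)\<^sup>2 \<le> C2 * ?D" .
        qed simp
        finally show ?thesis by (simp add: algebra_simps)
      qed
      have "r\<^sup>2 * (cmod (y t))\<^sup>2 = r\<^sup>2 * (cmod (v t + (- \<tau>) *\<^sub>R y1 t))\<^sup>2" by (simp add: v_def)
      also have "\<dots> \<le> r\<^sup>2 * (2 * (cmod (v t))\<^sup>2 + 2 * (- \<tau>)\<^sup>2 * (cmod (y1 t))\<^sup>2)"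
        by (intro mult_left_mono sq_add) auto
      also have "\<dots> \<le> C1 * energy \<tau> k r (v t) (w t) (y1 t)"
      proof -
        have "C1 * energy \<tau> k r (v t) (w t) (y1 t)
            - r\<^sup>2 * (2 * (cmod (v t))\<^sup>2 + 2 * (- \<tau>)\<^sup>2 * (cmod (y1 t))\<^sup>2)
          = C1 * (cmod (w t))\<^sup>2 + 2 * \<tau> / k * (r\<^sup>2 * (cmod (v t))\<^sup>2)
            + 2 * (\<tau> * k * r\<^sup>2 * (cmod (y1 t))\<^sup>2)"
          unfolding C1_def energy_def power2_norm_eq_inner
          using k by (simp add: field_simps power2_eq_square[of \<tau>])
        also have "\<dots> \<ge> 0" using C1 assms k by simp
        finally show ?thesis by simp
      qed
      also have "\<dots> \<le> C1 * (3 * exp (- c * (r\<^sup>2 / (1 + r\<^sup>2)) * t) * energy \<tau> k r (v 0) (w 0) (y1 0))"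
        using C1 by (intro mult_left_mono decay dv dw dz t) auto
      also have "\<dots> \<le> C1 * (3 * exp (- (c / 2) * min 1 (r\<^sup>2) * t) * (C2 * (max 1 (r\<^sup>2) * ?D)))"
      proof (intro mult_left_mono mult_mono E0)
        have "c * (min 1 (r\<^sup>2) / 2) * t \<le> c * (r\<^sup>2 / (1 + r\<^sup>2)) * t"
          using min_one_le_frac[of r] c t by (intro mult_right_mono mult_left_mono) auto
        then show "exp (- c * (r\<^sup>2 / (1 + r\<^sup>2)) * t) \<le> exp (- (c / 2) * min 1 (r\<^sup>2) * t)"
          by (simp add: mult.assoc)
        show "0 \<le> energy \<tau> k r (v 0) (w 0) (y1 0)" using assms k by (simp add: energy_def)
      qed (use C1 in auto)
      finally show "r\<^sup>2 * (cmod (y t))\<^sup>2 \<le> C1 * 3 * C2 * max 1 (r\<^sup>2) * exp (- (c / 2) * min 1 (r\<^sup>2) * t) * ?D"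
        by (simp add: algebra_simps)
    qed
  qed
qed

section \<open>The nonreal eigenvalues at low frequency\<close>

text \<open>
  The imaginary part of the equation is \<open>Im z (2 \<tau> Re z + b) = 0\<close>, which fixes the real part of a
  nonreal root.
\<close>

lemma quadratic_upper_root_iff:
  fixes b d \<tau> :: real
  assumes "0 < \<tau>" "b\<^sup>2 < 4 * \<tau> * d"
  shows "complex_of_real \<tau> * z\<^sup>2 + complex_of_real b * z + complex_of_real d = 0 \<and> Im z > 0 \<longleftrightarrow>
    z = Complex (- b / (2 * \<tau>)) (sqrt (4 * \<tau> * d - b\<^sup>2) / (2 * \<tau>))"
    (is "?P \<and> ?Q \<longleftrightarrow> z = ?z")
proof -
  define S where "S = sqrt (4 * \<tau> * d - b\<^sup>2)"
  have S: "0 < S" "S\<^sup>2 = 4 * \<tau> * d - b\<^sup>2" using assms(2) by (simp_all add: S_def)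
  obtain x y where z: "z = Complex x y" by (cases z)
  have P: "?P \<longleftrightarrow> \<tau> * (x\<^sup>2 - y\<^sup>2) + b * x + d = 0 \<and> y * (2 * \<tau> * x + b) = 0"
    unfolding z by (simp add: complex_eq_iff power2_eq_square algebra_simps)
  have "?P \<and> ?Q \<longleftrightarrow> x = - b / (2 * \<tau>) \<and> y = S / (2 * \<tau>)"
  proof
    assume "?P \<and> ?Q"
    then have y: "0 < y" and e1: "\<tau> * (x\<^sup>2 - y\<^sup>2) + b * x + d = 0" and e2: "2 * \<tau> * x = - b"
      unfolding P by (auto simp: z)
    have "(2 * \<tau> * y)\<^sup>2 = 4 * \<tau> * (\<tau> * x\<^sup>2 + b * x + d)"
      using e1 by (simp add: power2_eq_square algebra_simps)
    also have "\<dots> = (2 * \<tau> * x)\<^sup>2 + 2 * b * (2 * \<tau> * x) + 4 * \<tau> * d"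
      by (simp add: power2_eq_square algebra_simps)
    also have "\<dots> = S\<^sup>2" unfolding e2 S(2) by (simp add: power2_eq_square)
    finally have "2 * \<tau> * y = S" using y S(1) assms(1) by (simp add: power2_eq_iff_nonneg)
    with e2 show "x = - b / (2 * \<tau>) \<and> y = S / (2 * \<tau>)"
      using assms(1) by (simp add: field_simps)
  next
    assume xy: "x = - b / (2 * \<tau>) \<and> y = S / (2 * \<tau>)"
    then have e: "2 * \<tau> * x = - b" "2 * \<tau> * y = S" using assms(1) by auto
    have "4 * \<tau> * (\<tau> * (x\<^sup>2 - y\<^sup>2) + b * x + d)
        = (2 * \<tau> * x)\<^sup>2 - (2 * \<tau> * y)\<^sup>2 + 2 * b * (2 * \<tau> * x) + 4 * \<tau> * d"
      by (simp add: power2_eq_square algebra_simps)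
    also have "\<dots> = 0" unfolding e S(2) by (simp add: power2_eq_square)
    finally have "\<tau> * (x\<^sup>2 - y\<^sup>2) + b * x + d = 0" using assms(1) by simp
    with xy show "?P \<and> ?Q" unfolding P using S(1) assms(1) by (simp add: z)
  qed
  then show ?thesis by (simp add: z S_def)
qed

lemma char_root_factor:
  fixes x0 \<tau> \<beta> r :: real
  assumes "char_root \<tau> \<beta> r (complex_of_real x0)"
  shows "char_root \<tau> \<beta> r z \<longleftrightarrow> z = complex_of_real x0 \<or>
    complex_of_real \<tau> * z\<^sup>2 + complex_of_real (1 + \<tau> * x0) * z
      + complex_of_real (\<beta> * r\<^sup>2 + x0 * (1 + \<tau> * x0)) = 0"
proof -
  let ?p = "\<lambda>z. complex_of_real \<tau> * z ^ 3 + z\<^sup>2 + complex_of_real (\<beta> * r\<^sup>2) * z + complex_of_real (r\<^sup>2)"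
  have "?p z = ?p z - ?p (complex_of_real x0)" using assms by (simp add: char_root_def)
  also have "\<dots> = (z - complex_of_real x0) * (complex_of_real \<tau> * z\<^sup>2 + complex_of_real (1 + \<tau> * x0) * z
      + complex_of_real (\<beta> * r\<^sup>2 + x0 * (1 + \<tau> * x0)))"
    by (simp add: algebra_simps power2_eq_square power3_eq_cube)
  finally show ?thesis by (simp add: char_root_def)
qed

text \<open>
  The characteristic polynomial takes the values \<open>- r\<^sup>2 (\<beta> - \<tau>) / \<tau>\<close> at \<open>- 1 / \<tau>\<close> and
  \<open>(\<beta> - \<tau>) / \<beta>\<^sup>3\<close> at \<open>- 1 / \<beta>\<close>, which have opposite signs.
\<close>

lemma real_char_root:
  fixes \<tau> \<beta> r :: real
  assumes "0 < \<tau>" "\<tau> < \<beta>" "0 < r"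
  obtains x0 where "- 1 / \<tau> < x0" "x0 < - 1 / \<beta>" "char_root \<tau> \<beta> r (complex_of_real x0)"
proof -
  define p where "p x = \<tau> * x ^ 3 + x\<^sup>2 + \<beta> * r\<^sup>2 * x + r\<^sup>2" for x :: real
  have pl: "p (- 1 / \<tau>) < 0"
  proof -
    have "p (- 1 / \<tau>) = - (r\<^sup>2 * (\<beta> - \<tau>) / \<tau>)"
      using assms by (simp add: p_def field_simps power2_eq_square power3_eq_cube)
    also have "\<dots> < 0" using assms by simp
    finally show ?thesis .
  qed
  have pr: "0 < p (- 1 / \<beta>)"
  proof -
    have "p (- 1 / \<beta>) = (\<beta> - \<tau>) / \<beta> ^ 3"
      using assms by (simp add: p_def field_simps power2_eq_square power3_eq_cube)
    also have "\<dots> > 0" using assms by simp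
    finally show ?thesis .
  qed
  have "- 1 / \<tau> \<le> - 1 / \<beta>" using assms by (simp add: field_simps)
  moreover have "continuous_on {- 1 / \<tau> .. - 1 / \<beta>} p"
    unfolding p_def by (intro continuous_intros)
  ultimately obtain x0 where x0: "- 1 / \<tau> \<le> x0" "x0 \<le> - 1 / \<beta>" "p x0 = 0"
    using IVT'[of p "- 1 / \<tau>" 0 "- 1 / \<beta>"] pl pr by auto
  have "- 1 / \<tau> < x0" "x0 < - 1 / \<beta>"
    using x0 pl pr by (metis less_eq_real_def less_irrefl)+
  moreover have "char_root \<tau> \<beta> r (complex_of_real x0)"
  proof -
    have "complex_of_real \<tau> * complex_of_real x0 ^ 3 + (complex_of_real x0)\<^sup>2
        + complex_of_real (\<beta> * r\<^sup>2) * complex_of_real x0 + complex_of_real (r\<^sup>2)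
      = complex_of_real (p x0)" by (simp add: p_def)
    then show ?thesis using x0(3) by (simp add: char_root_def)
  qed
  ultimately show ?thesis by (rule that)
qed

text \<open>
  Divide out the real root \<open>x0\<close> of \<open>real_char_root\<close>. The nonreal pair are the roots of
  \<open>\<tau> z\<^sup>2 + b z + d\<close> with \<open>b = 1 + \<tau> x0 > 0\<close>, so their real part is \<open>- b / (2 \<tau>)\<close>. As \<open>r\<close> tends
  to 0 the real root tends to \<open>- 1 / \<tau>\<close>, with \<open>b\<close> of order \<open>r\<^sup>2\<close>, while \<open>d\<close> is at least
  \<open>\<tau> r\<^sup>2\<close>: hence the discriminant is negative for small \<open>r\<close>.
\<close>

lemma Re_lambda2_small:
  fixes \<tau> \<beta> r :: real
  assumes "0 < \<tau>" "\<tau> < \<beta>" "0 < r" "r < 2 * \<tau>\<^sup>2 / \<beta> ^ 3"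
  shows "Re (lambda2 \<tau> \<beta> r) < 0" "- (r\<^sup>2 * \<beta> ^ 3 / (2 * \<tau>\<^sup>2)) \<le> Re (lambda2 \<tau> \<beta> r)"
proof -
  obtain x0 where x0: "- 1 / \<tau> < x0" "x0 < - 1 / \<beta>" and root: "char_root \<tau> \<beta> r (complex_of_real x0)"
    using real_char_root[OF assms(1-3)] by blast
  define q where "q = - x0"
  have q: "1 / \<beta> < q" "q < 1 / \<tau>" using x0 by (simp_all add: q_def)
  have q0: "0 < q" using q assms by (meson less_trans zero_less_divide_1_iff)
  define b where "b = 1 + \<tau> * x0"
  define d where "d = \<beta> * r\<^sup>2 + x0 * b"
  have p: "\<tau> * x0 ^ 3 + x0\<^sup>2 + \<beta> * r\<^sup>2 * x0 + r\<^sup>2 = 0"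
  proof -
    have "complex_of_real (\<tau> * x0 ^ 3 + x0\<^sup>2 + \<beta> * r\<^sup>2 * x0 + r\<^sup>2) = 0"
      using root by (simp add: char_root_def)
    then show ?thesis by (simp only: of_real_eq_0_iff)
  qed
  have b0: "0 < b" using q(2) assms(1) by (simp add: b_def q_def field_simps)
  have bq: "b * q\<^sup>2 = r\<^sup>2 * (\<beta> * q - 1)"
    using p by (simp add: b_def q_def algebra_simps power2_eq_square power3_eq_cube)
  have dq: "d * q = r\<^sup>2"
    using p by (simp add: d_def b_def q_def algebra_simps power2_eq_square power3_eq_cube)
  have b_le: "b \<le> r\<^sup>2 * \<beta> ^ 3 / \<tau>"
  proof -
    have "1 \<le> (\<beta> * q)\<^sup>2" using q(1) assms by (intro one_le_power) (simp add: field_simps)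
    then have "b \<le> b * (\<beta> * q)\<^sup>2" using b0 by simp
    also have "\<dots> = \<beta>\<^sup>2 * (r\<^sup>2 * (\<beta> * q - 1))" by (simp add: bq[symmetric] power_mult_distrib)
    also have "\<dots> \<le> \<beta>\<^sup>2 * (r\<^sup>2 * (\<beta> * (1 / \<tau>)))"
    proof -
      have "\<beta> * q - 1 \<le> \<beta> * (1 / \<tau>)" using mult_left_mono[of q "1 / \<tau>" \<beta>] q assms by simp
      then show ?thesis by (intro mult_left_mono) auto
    qed
    also have "\<dots> = r\<^sup>2 * \<beta> ^ 3 / \<tau>" by (simp add: power2_eq_square power3_eq_cube)
    finally show ?thesis .
  qed
  have d_ge: "\<tau> * r\<^sup>2 \<le> d"
  proof -
    have d0: "0 < d" using dq q0 assms(3) by (metis zero_less_mult_pos2 zero_less_power)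
    have "\<tau> * (d * q) \<le> d * (\<tau> * (1 / \<tau>))"
      using d0 q assms by (simp add: field_simps)
    then show ?thesis using assms by (simp add: dq)
  qed
  \<comment> \<open>The assumed bound on \<open>r\<close> is what makes \<open>b < 2 \<tau> r\<close>, hence the discriminant negative.\<close>
  have disc: "b\<^sup>2 < 4 * \<tau> * d"
  proof -
    have "r * \<beta> ^ 3 < 2 * \<tau>\<^sup>2" using assms by (simp add: field_simps)
    then have "r * (r * \<beta> ^ 3) / \<tau> < r * (2 * \<tau>\<^sup>2) / \<tau>"
      using assms by (intro divide_strict_right_mono mult_strict_left_mono) auto
    then have "r\<^sup>2 * \<beta> ^ 3 / \<tau> < 2 * \<tau> * r" using assms by (simp add: power2_eq_square field_simps)
    with b_le have "b < 2 * \<tau> * r" by simp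
    then have "b\<^sup>2 < (2 * \<tau> * r)\<^sup>2" using b0 by (intro power_strict_mono) auto
    also have "\<dots> = 4 * \<tau> * (\<tau> * r\<^sup>2)" by (simp add: power2_eq_square)
    also have "\<dots> \<le> 4 * \<tau> * d" using d_ge assms by (intro mult_left_mono) auto
    finally show ?thesis .
  qed
  have "char_root \<tau> \<beta> r z \<and> Im z > 0 \<longleftrightarrow>
      z = Complex (- b / (2 * \<tau>)) (sqrt (4 * \<tau> * d - b\<^sup>2) / (2 * \<tau>))" for z
    unfolding char_root_factor[OF root] quadratic_upper_root_iff[OF assms(1) disc, symmetric]
    by (auto simp: b_def d_def)
  then have "lambda2 \<tau> \<beta> r = Complex (- b / (2 * \<tau>)) (sqrt (4 * \<tau> * d - b\<^sup>2) / (2 * \<tau>))"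
    unfolding lambda2_def by simp
  then have Re: "Re (lambda2 \<tau> \<beta> r) = - b / (2 * \<tau>)" by simp
  show "Re (lambda2 \<tau> \<beta> r) < 0" unfolding Re using b0 assms(1) by simp
  have "b / (2 * \<tau>) \<le> r\<^sup>2 * \<beta> ^ 3 / \<tau> / (2 * \<tau>)" using b_le assms(1) by (intro divide_right_mono) auto
  then show "- (r\<^sup>2 * \<beta> ^ 3 / (2 * \<tau>\<^sup>2)) \<le> Re (lambda2 \<tau> \<beta> r)"
    unfolding Re by (simp add: power2_eq_square)
qed

lemma decay_rate_small:
  fixes \<tau> \<beta> \<delta> :: real
  assumes "0 < \<tau>" "\<tau> < \<beta>" "0 < \<delta>"
  obtains \<nu>0 where "0 < \<nu>0"
    "\<And>\<nu>. 0 < \<nu> \<Longrightarrow> \<nu> \<le> \<nu>0 \<Longrightarrow> 0 < decay_rate \<tau> \<beta> \<nu> \<and> decay_rate \<tau> \<beta> \<nu> \<le> \<delta>"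
proof -
  define A where "A = \<beta> ^ 3 / (2 * \<tau>\<^sup>2)"
  have A: "0 < A" using assms by (simp add: A_def)
  \<comment> \<open>The first bound is half the threshold of \<open>Re_lambda2_small\<close>, the second makes \<open>A \<nu>\<^sup>2 \<le> \<delta>\<close>.\<close>
  define \<nu>0 where "\<nu>0 = min (1 / (2 * A)) (sqrt (\<delta> / A))"
  show ?thesis
  proof (rule that[of \<nu>0])
    show "0 < \<nu>0" using A assms(3) by (simp add: \<nu>0_def)
    fix \<nu> :: real assume \<nu>: "0 < \<nu>" "\<nu> \<le> \<nu>0"
    have "\<nu> < 1 / A" using \<nu> A by (auto simp: \<nu>0_def field_simps)
    then have small: "\<nu> < 2 * \<tau>\<^sup>2 / \<beta> ^ 3" by (simp add: A_def)
    have "\<nu>\<^sup>2 \<le> (sqrt (\<delta> / A))\<^sup>2" using \<nu> by (intro power_mono) (auto simp: \<nu>0_def)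
    then have "\<nu>\<^sup>2 \<le> \<delta> / A" using A assms(3) by simp
    then have "\<nu>\<^sup>2 * A \<le> \<delta>" using A by (simp add: field_simps)
    then show "0 < decay_rate \<tau> \<beta> \<nu> \<and> decay_rate \<tau> \<beta> \<nu> \<le> \<delta>"
      using Re_lambda2_small[OF assms(1,2) \<nu>(1) small] assms
      by (auto simp: decay_rate_def A_def min_le_iff_disj)
  qed
qed

section \<open>Gaussians and their Fourier transforms\<close>

lemma product_sigma_finite_lborel: "product_sigma_finite (\<lambda>_::nat. lborel :: real measure)"
  by standard

lemma sigma_finite_leb: "sigma_finite_measure (leb N)"
  by (intro product_sigma_finite.sigma_finite product_sigma_finite_lborel) simp

lemma pair_sigma_finite_leb: "pair_sigma_finite (leb N) (leb M)"
  by (intro pair_sigma_finite.intro sigma_finite_leb)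

text \<open>
  This is the characteristic function of the standard normal distribution, rescaled by \<open>\<sigma>\<close>.
\<close>

lemma gaussian_fourier_real:
  fixes \<sigma> s :: real assumes \<sigma>: "0 < \<sigma>"
  shows "integrable lborel (\<lambda>x. exp (- (x\<^sup>2 / (2 * \<sigma>\<^sup>2))))"
    and "(LINT x|lborel. exp (\<i> * complex_of_real (x * s)) * complex_of_real (exp (- (x\<^sup>2 / (2 * \<sigma>\<^sup>2)))))
      = complex_of_real (2 * pi * normal_density 0 (1 / \<sigma>) s)"
proof -
  have eq: "exp (- (x\<^sup>2 / (2 * \<sigma>\<^sup>2))) = sqrt (2 * pi * \<sigma>\<^sup>2) * normal_density 0 \<sigma> x" for x
    using \<sigma> by (simp add: normal_density_def)
  show "integrable lborel (\<lambda>x. exp (- (x\<^sup>2 / (2 * \<sigma>\<^sup>2))))"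
    unfolding eq using \<sigma> by (intro integrable_mult_right integrable_normal_density) auto
  have std: "(LINT x|lborel. complex_of_real (std_normal_density x) * exp (\<i> * complex_of_real (u * x)))
      = complex_of_real (exp (- (u\<^sup>2) / 2))" for u
  proof -
    have "complex_of_real (exp (- (u\<^sup>2) / 2)) = char std_normal_distribution u"
      by (simp add: char_std_normal_distribution)
    also have "\<dots> = (LINT x|lborel. std_normal_density x *\<^sub>R exp (\<i> * complex_of_real (u * x)))"
      unfolding char_def by (subst integral_density) auto
    finally show ?thesis by (simp add: scaleR_conv_of_real)
  qed
  have "(LINT x|lborel. exp (\<i> * complex_of_real (x * s)) * complex_of_real (exp (- (x\<^sup>2 / (2 * \<sigma>\<^sup>2)))))
    = \<sigma> *\<^sub>R (LINT x|lborel. exp (\<i> * complex_of_real ((0 + \<sigma> * x) * s))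
        * complex_of_real (exp (- ((0 + \<sigma> * x)\<^sup>2 / (2 * \<sigma>\<^sup>2)))))"
    using \<sigma> by (subst lborel_integral_real_affine[of \<sigma> _ 0]) simp_all
  also have "(\<lambda>x. exp (\<i> * complex_of_real ((0 + \<sigma> * x) * s)) * complex_of_real (exp (- ((0 + \<sigma> * x)\<^sup>2 / (2 * \<sigma>\<^sup>2)))))
     = (\<lambda>x. complex_of_real (sqrt (2 * pi)) * (complex_of_real (std_normal_density x) * exp (\<i> * complex_of_real (\<sigma> * s * x))))"
    using \<sigma> by (intro ext) (simp add: std_normal_density_def power_mult_distrib mult_ac)
  also have "(LINT x|lborel. complex_of_real (sqrt (2 * pi)) * (complex_of_real (std_normal_density x) * exp (\<i> * complex_of_real (\<sigma> * s * x))))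
     = complex_of_real (sqrt (2 * pi)) * complex_of_real (exp (- ((\<sigma> * s)\<^sup>2) / 2))"
    unfolding integral_mult_right_zero std ..
  also have "\<sigma> *\<^sub>R \<dots> = complex_of_real (2 * pi * normal_density 0 (1 / \<sigma>) s)"
  proof -
    have "sqrt (2 * pi * (1 / \<sigma>)\<^sup>2) = sqrt (2 * pi) / \<sigma>"
      using \<sigma> by (simp add: real_sqrt_mult real_sqrt_divide)
    then have "2 * pi / sqrt (2 * pi * (1 / \<sigma>)\<^sup>2) = \<sigma> * (2 * pi / sqrt (2 * pi))"
      by simp
    also have "\<dots> = \<sigma> * sqrt (2 * pi)" by (subst real_div_sqrt) simp_all
    finally have norm: "2 * pi / sqrt (2 * pi * (1 / \<sigma>)\<^sup>2) = \<sigma> * sqrt (2 * pi)" .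
    have "2 * pi * normal_density 0 (1 / \<sigma>) s
        = 2 * pi / sqrt (2 * pi * (1 / \<sigma>)\<^sup>2) * exp (- ((\<sigma> * s)\<^sup>2) / 2)"
      using \<sigma> unfolding normal_density_def by (simp add: power_mult_distrib power_divide)
    then have "2 * pi * normal_density 0 (1 / \<sigma>) s = \<sigma> * (sqrt (2 * pi) * exp (- ((\<sigma> * s)\<^sup>2) / 2))"
      unfolding norm by simp
    then show ?thesis by (simp add: scaleR_conv_of_real)
  qed
  finally show "(LINT x|lborel. exp (\<i> * complex_of_real (x * s)) * complex_of_real (exp (- (x\<^sup>2 / (2 * \<sigma>\<^sup>2)))))
      = complex_of_real (2 * pi * normal_density 0 (1 / \<sigma>) s)" .
qed

text \<open>
  The damping factor \<open>exp (- |\<xi>|\<^sup>2 / (2 \<sigma>\<^sup>2))\<close>, in product form so that integrals over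
  \<open>\<real>\<^sup>N\<close> factorise.
\<close>

definition heat :: "nat \<Rightarrow> real \<Rightarrow> (nat \<Rightarrow> real) \<Rightarrow> real"
  where "heat N \<sigma> \<xi> = (\<Prod>i<N. exp (- ((\<xi> i)\<^sup>2 / (2 * \<sigma>\<^sup>2))))"

text \<open>
  The Gaussian approximate identity of width \<open>1 / \<sigma>\<close>; up to a constant it is the Fourier transform
  of \<open>heat\<close> at \<open>x - y\<close>.
\<close>

definition mollifier :: "nat \<Rightarrow> real \<Rightarrow> (nat \<Rightarrow> real) \<Rightarrow> (nat \<Rightarrow> real) \<Rightarrow> real"
  where "mollifier N \<sigma> x y = (\<Prod>i<N. normal_density (y i) (1 / \<sigma>) (x i))"

lemma heat_pos: "0 < heat N \<sigma> \<xi>"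
  by (simp add: heat_def prod_pos)

lemma heat_measurable [measurable]: "heat N \<sigma> \<in> borel_measurable (leb N)"
  unfolding heat_def by measurable

lemma integrable_heat:
  assumes "0 < \<sigma>" shows "integrable (leb N) (heat N \<sigma>)"
  unfolding heat_def
  by (intro product_sigma_finite.product_integrable_prod product_sigma_finite_lborel
      gaussian_fourier_real assms) simp

lemma mollifier_nonneg: "0 \<le> mollifier N \<sigma> x y"
  by (simp add: mollifier_def prod_nonneg)

lemma mollifier_commute: "mollifier N \<sigma> x y = mollifier N \<sigma> y x"
  unfolding mollifier_def normal_density_def by (simp add: power2_commute)

lemma mollifier_measurable [measurable]:
  "(\<lambda>(x, y). mollifier N \<sigma> x y) \<in> borel_measurable (leb N \<Otimes>\<^sub>M leb N)"
  unfolding mollifier_def normal_density_def by measurable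

lemma nn_integral_mollifier:
  assumes "0 < \<sigma>"
  shows "(\<integral>\<^sup>+x. ennreal (mollifier N \<sigma> x y) \<partial>leb N) = 1"
proof -
  have "(\<integral>\<^sup>+x. ennreal (mollifier N \<sigma> x y) \<partial>leb N)
      = (\<integral>\<^sup>+x. (\<Prod>i<N. ennreal (normal_density (y i) (1 / \<sigma>) (x i))) \<partial>leb N)"
    by (simp add: mollifier_def prod_ennreal)
  also have "\<dots> = (\<Prod>i<N. \<integral>\<^sup>+x. ennreal (normal_density (y i) (1 / \<sigma>) x) \<partial>lborel)"
    by (intro product_sigma_finite.product_nn_integral_prod product_sigma_finite_lborel) auto
  also have "\<dots> = 1"
    using assms by (intro prod.neutral ballI)
      (simp add: nn_integral_eq_integral integrable_normal_density integral_normal_density)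
  finally show ?thesis .
qed

lemma heat_fourier:
  assumes \<sigma>: "0 < \<sigma>"
  shows "(LINT \<xi>|leb N. exp (\<i> * complex_of_real (\<Sum>i<N. (x i - y i) * \<xi> i)) * complex_of_real (heat N \<sigma> \<xi>))
    = complex_of_real ((2 * pi) ^ N * mollifier N \<sigma> x y)"
proof -
  let ?f = "\<lambda>i \<xi>. exp (\<i> * complex_of_real (\<xi> * (x i - y i))) * complex_of_real (exp (- (\<xi>\<^sup>2 / (2 * \<sigma>\<^sup>2))))"
  have int: "integrable lborel (?f i)" for i
    by (rule Bochner_Integration.integrable_bound[OF gaussian_fourier_real(1)[OF \<sigma>]])
      (auto simp: norm_mult)
  have "(LINT \<xi>|leb N. exp (\<i> * complex_of_real (\<Sum>i<N. (x i - y i) * \<xi> i)) * complex_of_real (heat N \<sigma> \<xi>))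
     = (LINT \<xi>|leb N. (\<Prod>i<N. ?f i (\<xi> i)))"
    by (intro Bochner_Integration.integral_cong refl)
      (simp add: heat_def prod.distrib exp_sum sum_distrib_left mult_ac flip: of_real_prod)
  also have "\<dots> = (\<Prod>i<N. LINT \<xi>|lborel. ?f i \<xi>)"
    by (intro product_sigma_finite.product_integral_prod product_sigma_finite_lborel int) simp
  also have "\<dots> = (\<Prod>i<N. complex_of_real (2 * pi * normal_density (y i) (1 / \<sigma>) (x i)))"
    unfolding gaussian_fourier_real(2)[OF \<sigma>] by (simp add: normal_density_def)
  also have "\<dots> = complex_of_real ((2 * pi) ^ N * mollifier N \<sigma> x y)"
    by (simp add: mollifier_def prod.distrib)
  finally show ?thesis .
qed

section \<open>Damped Plancherel identity\<close>

lemma cnj_measurable [measurable]: "cnj \<in> borel_measurable borel"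
  by (intro borel_measurable_continuous_onI continuous_intros)

lemma norm_integral_le_nn_integral:
  fixes f :: "'a \<Rightarrow> 'b :: {banach, second_countable_topology}"
  shows "ennreal (norm (integral\<^sup>L M f)) \<le> (\<integral>\<^sup>+x. ennreal (norm (f x)) \<partial>M)"
  by (cases "integrable M f") (auto simp: integral_norm_bound_ennreal not_integrable_integral_eq)

lemma integrable_leb_tensor:
  fixes F :: "(nat \<Rightarrow> real) \<times> (nat \<Rightarrow> real) \<Rightarrow> complex"
  assumes [measurable]: "F \<in> borel_measurable (leb N \<Otimes>\<^sub>M leb N)"
    and a: "integrable (leb N) a" and b: "integrable (leb N) b"
    and le: "\<And>x y. cmod (F (x, y)) \<le> cmod (a x :: complex) * cmod (b y :: complex)"
  shows "integrable (leb N \<Otimes>\<^sub>M leb N) F"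
proof -
  interpret sigma_finite_measure "leb N" by (rule sigma_finite_leb)
  note [measurable] = borel_measurable_integrable[OF a] borel_measurable_integrable[OF b]
  have "(\<integral>\<^sup>+p. ennreal (cmod (F p)) \<partial>(leb N \<Otimes>\<^sub>M leb N))
      = (\<integral>\<^sup>+x. \<integral>\<^sup>+y. ennreal (cmod (F (x, y))) \<partial>leb N \<partial>leb N)"
    by (subst nn_integral_fst[symmetric]) auto
  also have "\<dots> \<le> (\<integral>\<^sup>+x. \<integral>\<^sup>+y. ennreal (cmod (a x)) * ennreal (cmod (b y)) \<partial>leb N \<partial>leb N)"
    by (intro nn_integral_mono) (simp add: le flip: ennreal_mult)
  also have "\<dots> = (\<integral>\<^sup>+x. ennreal (cmod (a x)) \<partial>leb N) * (\<integral>\<^sup>+y. ennreal (cmod (b y)) \<partial>leb N)"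
    by (simp add: nn_integral_cmult nn_integral_multc)
  also have "\<dots> < \<infinity>"
    using a b by (simp add: integrable_iff_bounded ennreal_mult_less_top)
  finally show ?thesis by (simp add: integrable_iff_bounded)
qed

abbreviation fconst :: "nat \<Rightarrow> real"
  where "fconst N \<equiv> (2 * pi) powr (- real N / 2)"

definition wave :: "nat \<Rightarrow> (nat \<Rightarrow> real) \<Rightarrow> (nat \<Rightarrow> real) \<Rightarrow> complex"
  where "wave N x \<xi> = exp (- \<i> * complex_of_real (\<Sum>i<N. x i * \<xi> i))"

lemma fourier_eq_wave:
  "fourier N f \<xi> = complex_of_real (fconst N) * (LINT x|leb N. wave N x \<xi> * f x)"
  by (simp only: fourier_def wave_def)

lemma norm_wave [simp]: "cmod (wave N x \<xi>) = 1"
  by (simp add: wave_def norm_exp_eq_Re)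

lemma wave_measurable [measurable (raw)]:
  assumes [measurable (raw)]: "\<And>i. i \<in> {..<N} \<Longrightarrow> (\<lambda>p. f p i) \<in> borel_measurable M"
    "\<And>i. i \<in> {..<N} \<Longrightarrow> (\<lambda>p. g p i) \<in> borel_measurable M"
  shows "(\<lambda>p. wave N (f p) (g p)) \<in> borel_measurable M"
  unfolding wave_def by measurable

lemma wave_mult_cnj:
  "wave N x \<xi> * cnj (wave N y \<xi>) = exp (\<i> * complex_of_real (\<Sum>i<N. (y i - x i) * \<xi> i))"
proof -
  have "- \<i> * complex_of_real (\<Sum>i<N. x i * \<xi> i) + \<i> * complex_of_real (\<Sum>i<N. y i * \<xi> i)
      = \<i> * complex_of_real ((\<Sum>i<N. y i * \<xi> i) - (\<Sum>i<N. x i * \<xi> i))"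
    by (simp add: algebra_simps)
  also have "(\<Sum>i<N. y i * \<xi> i) - (\<Sum>i<N. x i * \<xi> i) = (\<Sum>i<N. (y i - x i) * \<xi> i)"
    by (simp add: left_diff_distrib sum_subtractf)
  finally show ?thesis by (simp only: wave_def exp_cnj exp_add[symmetric]) simp
qed

lemma fconst_le_1: "fconst N \<le> 1"
proof -
  have "1 \<le> 2 * pi" using pi_ge_two by simp
  then have "fconst N \<le> (2 * pi) powr 0" by (intro powr_mono) auto
  then show ?thesis by simp
qed

lemma fconst_square: "fconst N * fconst N * (2 * pi) ^ N = 1"
proof -
  have "fconst N * fconst N = (2 * pi) powr (- real N)" by (simp flip: powr_add)
  also have "\<dots> = inverse ((2 * pi) ^ N)" by (simp add: powr_minus powr_realpow)
  finally have "fconst N * fconst N * (2 * pi) ^ N = inverse ((2 * pi) ^ N) * (2 * pi) ^ N" by (rule arg_cong)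
  also have "\<dots> = 1" by (rule left_inverse) simp
  finally show ?thesis .
qed

lemma integrable_wave:
  assumes "in_L1 N f"
  shows "integrable (leb N) (\<lambda>x. wave N x \<xi> * f x)"
proof (rule Bochner_Integration.integrable_bound)
  show "integrable (leb N) f" using assms by (simp add: in_L1_def)
  then have [measurable]: "f \<in> borel_measurable (leb N)" by simp
  show "(\<lambda>x. wave N x \<xi> * f x) \<in> borel_measurable (leb N)" by measurable
qed (simp add: norm_mult)

lemma fourier_diff:
  assumes "in_L1 N f" "in_L1 N g"
  shows "fourier N (\<lambda>x. f x - g x) \<xi> = fourier N f \<xi> - fourier N g \<xi>"
  unfolding fourier_eq_wave
  by (simp only: right_diff_distrib Bochner_Integration.integral_diff integrable_wave assms)

lemma norm_fourier_le: "cmod (fourier N f \<xi>) \<le> L1_norm N f"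
proof -
  have "cmod (fourier N f \<xi>) = fconst N * cmod (LINT x|leb N. wave N x \<xi> * f x)"
    by (simp add: fourier_eq_wave norm_mult)
  also have "\<dots> \<le> 1 * (LINT x|leb N. cmod (wave N x \<xi> * f x))"
    by (intro mult_mono fconst_le_1 integral_norm_bound) auto
  finally show ?thesis by (simp add: L1_norm_def norm_mult)
qed

lemma fourier_measurable [measurable]:
  assumes "in_L1 N f" shows "fourier N f \<in> borel_measurable (leb N)"
proof -
  interpret sigma_finite_measure "leb N" by (rule sigma_finite_leb)
  have [measurable]: "f \<in> borel_measurable (leb N)" using assms by (simp add: in_L1_def)
  have "(\<lambda>\<xi>. LINT x|leb N. wave N x \<xi> * f x) \<in> borel_measurable (leb N)"
    by (rule borel_measurable_lebesgue_integral) measurable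
  then show ?thesis unfolding fourier_eq_wave by measurable
qed

text \<open>
  Insert the defining integrals of the two factors of \<open>|fourier f|\<^sup>2\<close> and integrate over the frequency
  first, which turns the damping factor into the mollifier. The damping is what makes both exchanges of
  integrals legitimate.
\<close>

lemma damped_plancherel:
  assumes f: "in_L1 N f" and \<sigma>: "0 < \<sigma>"
  shows "(LINT \<xi>|leb N. complex_of_real (heat N \<sigma> \<xi> * (cmod (fourier N f \<xi>))\<^sup>2))
    = (LINT x|leb N. f x * (LINT y|leb N. cnj (f y) * complex_of_real (mollifier N \<sigma> y x)))"
proof -
  interpret P: pair_sigma_finite "leb N" "leb N" by (rule pair_sigma_finite_leb)
  define c where "c = complex_of_real (fconst N)"
  define P where "P = complex_of_real ((2 * pi) ^ N)"
  define g where "g \<xi> = complex_of_real (heat N \<sigma> \<xi>)" for \<xi>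
  define h where "h = fourier N f"
  define m where "m y x = complex_of_real (mollifier N \<sigma> y x)" for y x
  have cP: "c * c * P = 1"
    unfolding c_def P_def of_real_mult[symmetric] fconst_square by simp
  have intf: "integrable (leb N) f" using f by (simp add: in_L1_def)
  have [measurable]: "f \<in> borel_measurable (leb N)" using intf by simp
  have [measurable]: "h \<in> borel_measurable (leb N)" unfolding h_def by (rule fourier_measurable[OF f])
  have [measurable]: "g \<in> borel_measurable (leb N)" unfolding g_def by measurable
  have intg: "integrable (leb N) (\<lambda>\<xi>. a * g \<xi>)" for a :: complex
    unfolding g_def by (intro integrable_mult_right integrable_of_real integrable_heat[OF \<sigma>])
  have h_eq: "h \<xi> = c * (LINT x|leb N. wave N x \<xi> * f x)" for \<xi>
    unfolding h_def c_def by (rule fourier_eq_wave)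
  have cnj_h: "cnj (h \<xi>) = c * (LINT y|leb N. cnj (wave N y \<xi> * f y))" for \<xi>
    unfolding h_eq c_def complex_cnj_mult[of "complex_of_real _"] complex_cnj_complex_of_real
    by (rule arg_cong[OF Bochner_Integration.integral_cnj[symmetric]])
  have norm_h: "cmod (h \<xi>) \<le> L1_norm N f" for \<xi> unfolding h_def by (rule norm_fourier_le)
  have L1: "0 \<le> L1_norm N f" by (simp add: L1_norm_def)
  \<comment> \<open>First exchange: expand only the conjugated transform, for fixed \<open>x\<close>.\<close>
  have inner: "(LINT \<xi>|leb N. g \<xi> * wave N x \<xi> * cnj (h \<xi>))
      = c * P * (LINT y|leb N. cnj (f y) * m y x)" for x
  proof -
    have 1: "g \<xi> * wave N x \<xi> * cnj (h \<xi>)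
        = (LINT y|leb N. (c * g \<xi> * wave N x \<xi>) * cnj (wave N y \<xi> * f y))" for \<xi>
      unfolding integral_mult_right_zero[of _ "c * g \<xi> * wave N x \<xi>"] cnj_h by (simp only: mult_ac)
    have 2: "integrable (leb N \<Otimes>\<^sub>M leb N)
          (\<lambda>(y, \<xi>). (c * g \<xi> * wave N x \<xi>) * cnj (wave N y \<xi> * f y))"
    proof (rule integrable_leb_tensor[OF _ intf intg[of c]])
      show "(\<lambda>(y, \<xi>). (c * g \<xi> * wave N x \<xi>) * cnj (wave N y \<xi> * f y))
          \<in> borel_measurable (leb N \<Otimes>\<^sub>M leb N)" by measurable
      fix y \<xi>
      show "cmod (case (y, \<xi>) of (y, \<xi>) \<Rightarrow> (c * g \<xi> * wave N x \<xi>) * cnj (wave N y \<xi> * f y))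
          \<le> cmod (f y) * cmod (c * g \<xi>)"
        unfolding prod.case norm_mult complex_mod_cnj norm_wave by (simp only: mult_ac mult_1_right mult_1_left order_refl)
    qed
    have 3: "(c * g \<xi> * wave N x \<xi>) * cnj (wave N y \<xi> * f y)
        = (c * cnj (f y)) * (exp (\<i> * complex_of_real (\<Sum>i<N. (y i - x i) * \<xi> i)) * g \<xi>)" for y \<xi>
      unfolding wave_mult_cnj[symmetric] complex_cnj_mult by (simp only: mult_ac)
    have 4: "(c * cnj (f y)) * complex_of_real ((2 * pi) ^ N * mollifier N \<sigma> y x)
        = (c * P) * (cnj (f y) * m y x)" for y
      unfolding P_def m_def of_real_mult by (simp only: mult_ac)
    have "(LINT \<xi>|leb N. g \<xi> * wave N x \<xi> * cnj (h \<xi>))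
        = (LINT \<xi>|leb N. LINT y|leb N. (c * g \<xi> * wave N x \<xi>) * cnj (wave N y \<xi> * f y))"
      by (intro Bochner_Integration.integral_cong refl 1)
    also have "\<dots> = (LINT y|leb N. LINT \<xi>|leb N. (c * g \<xi> * wave N x \<xi>) * cnj (wave N y \<xi> * f y))"
      by (rule P.Fubini_integral[OF 2])
    also have "\<dots> = (LINT y|leb N. (c * P) * (cnj (f y) * m y x))"
      unfolding 3 integral_mult_right_zero[of _ "c * cnj (f _)"]
      unfolding g_def heat_fourier[OF \<sigma>] 4 ..
    finally show ?thesis unfolding integral_mult_right_zero[of _ "c * P"] .
  qed
  \<comment> \<open>Second exchange: expand the other factor.\<close>
  have 1: "complex_of_real (heat N \<sigma> \<xi> * (cmod (h \<xi>))\<^sup>2)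
      = (LINT x|leb N. (c * g \<xi> * cnj (h \<xi>)) * (wave N x \<xi> * f x))" for \<xi>
  proof -
    have "complex_of_real (heat N \<sigma> \<xi> * (cmod (h \<xi>))\<^sup>2) = g \<xi> * (h \<xi> * cnj (h \<xi>))"
      unfolding g_def of_real_mult complex_norm_square ..
    also have "\<dots> = (c * g \<xi> * cnj (h \<xi>)) * (LINT x|leb N. wave N x \<xi> * f x)"
      by (subst h_eq) (simp only: mult_ac)
    finally show ?thesis unfolding integral_mult_right_zero[of _ "c * g \<xi> * cnj (h \<xi>)"] .
  qed
  have 2: "integrable (leb N \<Otimes>\<^sub>M leb N) (\<lambda>(x, \<xi>). (c * g \<xi> * cnj (h \<xi>)) * (wave N x \<xi> * f x))"
  proof (rule integrable_leb_tensor[OF _ intf intg[of "c * complex_of_real (L1_norm N f)"]])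
    show "(\<lambda>(x, \<xi>). (c * g \<xi> * cnj (h \<xi>)) * (wave N x \<xi> * f x)) \<in> borel_measurable (leb N \<Otimes>\<^sub>M leb N)"
      by measurable
    fix x \<xi>
    have "cmod (f x) * (cmod c * cmod (g \<xi>)) * cmod (h \<xi>) \<le> cmod (f x) * (cmod c * cmod (g \<xi>)) * L1_norm N f"
      by (intro mult_left_mono norm_h) simp
    then show "cmod (case (x, \<xi>) of (x, \<xi>) \<Rightarrow> (c * g \<xi> * cnj (h \<xi>)) * (wave N x \<xi> * f x))
        \<le> cmod (f x) * cmod (c * complex_of_real (L1_norm N f) * g \<xi>)"
      unfolding prod.case norm_mult complex_mod_cnj norm_wave norm_of_real abs_of_nonneg[OF L1]
      by (simp only: mult_ac mult_1_right mult_1_left)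
  qed
  have 3: "(c * g \<xi> * cnj (h \<xi>)) * (wave N x \<xi> * f x) = (c * f x) * (g \<xi> * wave N x \<xi> * cnj (h \<xi>))" for x \<xi>
    by (simp only: mult_ac)
  have 4: "(c * f x) * (c * P * I) = f x * I" for x I
  proof -
    have "(c * f x) * (c * P * I) = (c * c * P) * (f x * I)" by (simp only: mult_ac)
    then show ?thesis unfolding cP by simp
  qed
  have "(LINT \<xi>|leb N. complex_of_real (heat N \<sigma> \<xi> * (cmod (h \<xi>))\<^sup>2))
      = (LINT \<xi>|leb N. LINT x|leb N. (c * g \<xi> * cnj (h \<xi>)) * (wave N x \<xi> * f x))"
    by (intro Bochner_Integration.integral_cong refl 1)
  also have "\<dots> = (LINT x|leb N. LINT \<xi>|leb N. (c * g \<xi> * cnj (h \<xi>)) * (wave N x \<xi> * f x))"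
    by (rule P.Fubini_integral[OF 2])
  also have "\<dots> = (LINT x|leb N. f x * (LINT y|leb N. cnj (f y) * m y x))"
    unfolding 3 integral_mult_right_zero[of _ "c * f _"] inner 4 ..
  finally show ?thesis by (simp only: h_def m_def)
qed

text \<open>
  The Schur test: \<open>|f x| |f y| \<le> (|f x|\<^sup>2 + |f y|\<^sup>2) / 2\<close>, and the mollifier has mass 1 in each variable.
\<close>

lemma mollified_form_bound:
  assumes [measurable]: "f \<in> borel_measurable (leb N)" and \<sigma>: "0 < \<sigma>"
  shows "ennreal (cmod (LINT x|leb N. f x * (LINT y|leb N. cnj (f y) * complex_of_real (mollifier N \<sigma> y x))))
    \<le> (\<integral>\<^sup>+x. ennreal ((cmod (f x))\<^sup>2) \<partial>leb N)" (is "_ \<le> ?S")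
proof -
  interpret P: pair_sigma_finite "leb N" "leb N" by (rule pair_sigma_finite_leb)
  let ?m = "\<lambda>x y. ennreal (mollifier N \<sigma> x y)"
  let ?q = "\<lambda>x. ennreal ((cmod (f x))\<^sup>2 / 2)"
  have m2: "(\<integral>\<^sup>+y. ?m y x \<partial>leb N) = 1" and m1: "(\<integral>\<^sup>+y. ?m x y \<partial>leb N) = 1" for x
    using nn_integral_mollifier[OF \<sigma>, of N x] by (simp_all add: mollifier_commute[of N \<sigma> x])
  have [measurable]: "(\<lambda>y. mollifier N \<sigma> y x) \<in> borel_measurable (leb N)"
    "mollifier N \<sigma> x \<in> borel_measurable (leb N)" for x
    unfolding mollifier_def normal_density_def by measurable
  have "ennreal (cmod (LINT x|leb N. f x * (LINT y|leb N. cnj (f y) * complex_of_real (mollifier N \<sigma> y x))))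
     \<le> (\<integral>\<^sup>+x. ennreal (cmod (f x * (LINT y|leb N. cnj (f y) * complex_of_real (mollifier N \<sigma> y x)))) \<partial>leb N)"
    by (rule norm_integral_le_nn_integral)
  also have "\<dots> \<le> (\<integral>\<^sup>+x. \<integral>\<^sup>+y. ?q x * ?m y x + ?q y * ?m y x \<partial>leb N \<partial>leb N)"
  proof (intro nn_integral_mono)
    fix x
    have "ennreal (cmod (f x * (LINT y|leb N. cnj (f y) * complex_of_real (mollifier N \<sigma> y x))))
      = ennreal (cmod (LINT y|leb N. f x * (cnj (f y) * complex_of_real (mollifier N \<sigma> y x))))"
      by simp
    also have "\<dots> \<le> (\<integral>\<^sup>+y. ennreal (cmod (f x * (cnj (f y) * complex_of_real (mollifier N \<sigma> y x)))) \<partial>leb N)"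
      by (rule norm_integral_le_nn_integral)
    also have "\<dots> \<le> (\<integral>\<^sup>+y. ?q x * ?m y x + ?q y * ?m y x \<partial>leb N)"
    proof (intro nn_integral_mono)
      fix y
      have "cmod (f x) * cmod (f y) \<le> (cmod (f x))\<^sup>2 / 2 + (cmod (f y))\<^sup>2 / 2"
        using sum_squares_bound[of "cmod (f x)" "cmod (f y)"] by simp
      then have "cmod (f x) * cmod (f y) * mollifier N \<sigma> y x
          \<le> ((cmod (f x))\<^sup>2 / 2 + (cmod (f y))\<^sup>2 / 2) * mollifier N \<sigma> y x"
        by (intro mult_right_mono mollifier_nonneg)
      then show "ennreal (cmod (f x * (cnj (f y) * complex_of_real (mollifier N \<sigma> y x))))
          \<le> ?q x * ?m y x + ?q y * ?m y x"
        using mollifier_nonneg[of N \<sigma> y x]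
        by (simp add: norm_mult ring_distribs mult.assoc ennreal_leI flip: ennreal_mult ennreal_plus)
    qed
    finally show "ennreal (cmod (f x * (LINT y|leb N. cnj (f y) * complex_of_real (mollifier N \<sigma> y x))))
      \<le> (\<integral>\<^sup>+y. ?q x * ?m y x + ?q y * ?m y x \<partial>leb N)" .
  qed
  also have "\<dots> = (\<integral>\<^sup>+x. \<integral>\<^sup>+y. ?q x * ?m y x \<partial>leb N \<partial>leb N) + (\<integral>\<^sup>+x. \<integral>\<^sup>+y. ?q y * ?m y x \<partial>leb N \<partial>leb N)"
    by (subst nn_integral_add[symmetric]) (auto simp: nn_integral_add)
  also have "(\<integral>\<^sup>+x. \<integral>\<^sup>+y. ?q y * ?m y x \<partial>leb N \<partial>leb N) = (\<integral>\<^sup>+y. \<integral>\<^sup>+x. ?q y * ?m y x \<partial>leb N \<partial>leb N)"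
    by (rule P.Fubini') measurable
  also have "\<dots> = (\<integral>\<^sup>+y. ?q y \<partial>leb N)"
    by (subst nn_integral_cmult) (simp_all add: m1)
  also have "(\<integral>\<^sup>+x. \<integral>\<^sup>+y. ?q x * ?m y x \<partial>leb N \<partial>leb N) = (\<integral>\<^sup>+x. ?q x \<partial>leb N)"
    by (subst nn_integral_cmult) (simp_all add: m2)
  also have "(\<integral>\<^sup>+x. ?q x \<partial>leb N) + (\<integral>\<^sup>+x. ?q x \<partial>leb N) = ?S"
    by (subst nn_integral_add[symmetric]) (simp_all flip: ennreal_plus)
  finally show ?thesis .
qed

section \<open>Plancherel inequality and uniqueness of the transform\<close>

text \<open>
  For every damping the damped integral is at most \<open>\<parallel>f\<parallel>\<^sup>2\<close>; remove the damping by letting \<open>\<sigma>\<close> tend to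
  infinity and apply Fatou's lemma.
\<close>

lemma plancherel_le:
  assumes f: "in_L1 N f" and f2: "in_L2 N f"
  shows "(\<integral>\<^sup>+\<xi>. ennreal ((cmod (fourier N f \<xi>))\<^sup>2) \<partial>leb N) \<le> (\<integral>\<^sup>+x. ennreal ((cmod (f x))\<^sup>2) \<partial>leb N)"
    (is "_ \<le> ?S")
proof -
  have [measurable]: "fourier N f \<in> borel_measurable (leb N)" by (rule fourier_measurable[OF f])
  have [measurable]: "f \<in> borel_measurable (leb N)" using f2 by (simp add: in_L2_def)
  let ?F = "\<lambda>\<sigma> \<xi>. heat N \<sigma> \<xi> * (cmod (fourier N f \<xi>))\<^sup>2"
  have F0: "0 \<le> ?F \<sigma> \<xi>" for \<sigma> \<xi> using heat_pos[of N \<sigma> \<xi>] by simp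
  have le: "(\<integral>\<^sup>+\<xi>. ennreal (?F \<sigma> \<xi>) \<partial>leb N) \<le> ?S" if \<sigma>: "0 < \<sigma>" for \<sigma>
  proof -
    have int: "integrable (leb N) (?F \<sigma>)"
    proof (rule Bochner_Integration.integrable_bound)
      show "integrable (leb N) (\<lambda>\<xi>. heat N \<sigma> \<xi> * (L1_norm N f)\<^sup>2)"
        using integrable_heat[OF \<sigma>] by simp
      show "?F \<sigma> \<in> borel_measurable (leb N)" by measurable
      show "AE \<xi> in leb N. norm (?F \<sigma> \<xi>) \<le> norm (heat N \<sigma> \<xi> * (L1_norm N f)\<^sup>2)"
        using heat_pos[of N \<sigma>]
        by (auto intro!: AE_I2 mult_left_mono power_mono norm_fourier_le simp: abs_mult less_imp_le)
    qed
    have "(\<integral>\<^sup>+\<xi>. ennreal (?F \<sigma> \<xi>) \<partial>leb N) = ennreal (LINT \<xi>|leb N. ?F \<sigma> \<xi>)"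
      by (rule nn_integral_eq_integral[OF int]) (simp add: F0)
    also have "\<dots> \<le> ennreal (cmod (LINT \<xi>|leb N. complex_of_real (?F \<sigma> \<xi>)))"
      unfolding integral_complex_of_real norm_of_real by (intro ennreal_leI) simp
    also have "\<dots> \<le> ?S"
      unfolding damped_plancherel[OF f \<sigma>] by (rule mollified_form_bound[OF _ \<sigma>]) simp
    finally show ?thesis .
  qed
  have lim: "(\<lambda>n. ennreal (?F (real (Suc n)) \<xi>)) \<longlonglongrightarrow> ennreal ((cmod (fourier N f \<xi>))\<^sup>2)" for \<xi>
  proof -
    have "(\<lambda>n. exp (- ((\<xi> i)\<^sup>2 / (2 * (real (Suc n))\<^sup>2)))) \<longlonglongrightarrow> exp (- ((\<xi> i)\<^sup>2 * 0))" for i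
    proof (intro tendsto_exp tendsto_minus)
      have "(\<lambda>n. (\<xi> i)\<^sup>2 * (1 / 2 * (inverse (real (Suc n)))\<^sup>2)) \<longlonglongrightarrow> (\<xi> i)\<^sup>2 * (1 / 2 * 0\<^sup>2)"
        by (intro tendsto_intros LIMSEQ_inverse_real_of_nat)
      then show "(\<lambda>n. (\<xi> i)\<^sup>2 / (2 * (real (Suc n))\<^sup>2)) \<longlonglongrightarrow> (\<xi> i)\<^sup>2 * 0"
        by (simp add: divide_simps del: of_nat_Suc)
    qed
    then have "(\<lambda>n. heat N (real (Suc n)) \<xi>) \<longlonglongrightarrow> (\<Prod>i<N. exp (- ((\<xi> i)\<^sup>2 * 0)))"
      unfolding heat_def by (intro tendsto_prod)
    then have "(\<lambda>n. ?F (real (Suc n)) \<xi>) \<longlonglongrightarrow> 1 * (cmod (fourier N f \<xi>))\<^sup>2"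
      by (intro tendsto_mult tendsto_const) simp
    then show ?thesis by (intro tendsto_ennrealI) simp
  qed
  have "(\<integral>\<^sup>+\<xi>. ennreal ((cmod (fourier N f \<xi>))\<^sup>2) \<partial>leb N)
      = (\<integral>\<^sup>+\<xi>. liminf (\<lambda>n. ennreal (?F (real (Suc n)) \<xi>)) \<partial>leb N)"
    by (intro nn_integral_cong lim_imp_Liminf[symmetric] lim) simp
  also have "\<dots> \<le> liminf (\<lambda>n. \<integral>\<^sup>+\<xi>. ennreal (?F (real (Suc n)) \<xi>) \<partial>leb N)"
    by (rule nn_integral_liminf) measurable
  also have "\<dots> \<le> liminf (\<lambda>n. ?S)" by (intro Liminf_mono always_eventually allI le) simp
  also have "\<dots> = ?S" by (simp add: Liminf_const)
  finally show ?thesis .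
qed

lemma in_L2_iff_nn_integral:
  "in_L2 N f \<longleftrightarrow> f \<in> borel_measurable (leb N) \<and> (\<integral>\<^sup>+x. ennreal ((cmod (f x))\<^sup>2) \<partial>leb N) < \<infinity>"
  by (auto simp: in_L2_def integrable_iff_bounded)

lemma L2_norm_eq_nn_integral:
  assumes "in_L2 N f"
  shows "(\<integral>\<^sup>+x. ennreal ((cmod (f x))\<^sup>2) \<partial>leb N) = ennreal ((L2_norm N f)\<^sup>2)"
  using assms by (subst nn_integral_eq_integral) (auto simp: in_L2_def L2_norm_def)

lemma in_L2_fourier: "in_L1 N f \<Longrightarrow> in_L2 N f \<Longrightarrow> in_L2 N (fourier N f)"
  using plancherel_le[of N f] by (auto simp: in_L2_iff_nn_integral fourier_measurable)

lemma L2_norm_fourier_le: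
  assumes "in_L1 N f" "in_L2 N f" shows "L2_norm N (fourier N f) \<le> L2_norm N f"
proof -
  have "ennreal ((L2_norm N (fourier N f))\<^sup>2) \<le> ennreal ((L2_norm N f)\<^sup>2)"
    using plancherel_le[OF assms] assms
    by (simp only: L2_norm_eq_nn_integral in_L2_fourier)
  then have "(L2_norm N (fourier N f))\<^sup>2 \<le> (L2_norm N f)\<^sup>2" by simp
  moreover have "0 \<le> L2_norm N f" by (simp add: L2_norm_def)
  ultimately show ?thesis by (rule power2_le_imp_le)
qed

lemma in_L2_diff:
  assumes "in_L2 N f" "in_L2 N g" shows "in_L2 N (\<lambda>x. f x - g x)"
    and "(L2_norm N (\<lambda>x. f x - g x))\<^sup>2 \<le> 2 * (L2_norm N f)\<^sup>2 + 2 * (L2_norm N g)\<^sup>2"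
proof -
  have [measurable]: "f \<in> borel_measurable (leb N)" "g \<in> borel_measurable (leb N)"
    and int: "integrable (leb N) (\<lambda>x. 2 * (cmod (f x))\<^sup>2 + 2 * (cmod (g x))\<^sup>2)"
    using assms by (auto simp: in_L2_def)
  have le: "(cmod (f x - g x))\<^sup>2 \<le> 2 * (cmod (f x))\<^sup>2 + 2 * (cmod (g x))\<^sup>2" for x
  proof -
    have "(cmod (f x - g x))\<^sup>2 \<le> (cmod (f x) + cmod (g x))\<^sup>2"
      by (intro power_mono norm_triangle_ineq4) auto
    also have "\<dots> \<le> 2 * (cmod (f x))\<^sup>2 + 2 * (cmod (g x))\<^sup>2"
      using sum_squares_bound[of "cmod (f x)" "cmod (g x)"] by (simp add: power2_sum)
    finally show ?thesis .
  qed
  have int': "integrable (leb N) (\<lambda>x. (cmod (f x - g x))\<^sup>2)"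
    by (rule Bochner_Integration.integrable_bound[OF int]) (use le in \<open>auto intro!: AE_I2\<close>)
  then show "in_L2 N (\<lambda>x. f x - g x)" by (simp add: in_L2_def)
  have "(LINT x|leb N. (cmod (f x - g x))\<^sup>2) \<le> (LINT x|leb N. 2 * (cmod (f x))\<^sup>2 + 2 * (cmod (g x))\<^sup>2)"
    by (intro integral_mono int int' le)
  also have "\<dots> = 2 * (LINT x|leb N. (cmod (f x))\<^sup>2) + 2 * (LINT x|leb N. (cmod (g x))\<^sup>2)"
    using assms by (subst Bochner_Integration.integral_add) (auto simp: in_L2_def)
  finally show "(L2_norm N (\<lambda>x. f x - g x))\<^sup>2 \<le> 2 * (L2_norm N f)\<^sup>2 + 2 * (L2_norm N g)\<^sup>2"
    by (simp add: L2_norm_def)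
qed

text \<open>
  If \<open>\<phi> n\<close> and \<open>\<psi> n\<close> both approximate \<open>f\<close>, then \<open>\<phi> n - \<psi> n\<close> tends to 0 in \<open>L\<^sup>2\<close>, hence so
  do the differences of their transforms by \<open>plancherel_le\<close>, and the two limits agree.
\<close>

lemma has_fourier_L2_unique:
  assumes "has_fourier_L2 N f g" "has_fourier_L2 N f h"
  shows "AE \<xi> in leb N. g \<xi> = h \<xi>"
proof -
  obtain \<phi> where \<phi>: "\<And>n. in_L1 N (\<phi> n)" "\<And>n. in_L2 N (\<phi> n)" "\<And>n. in_L2 N (fourier N (\<phi> n))"
      "(\<lambda>n. L2_norm N (\<lambda>x. \<phi> n x - f x)) \<longlonglongrightarrow> 0"
      "(\<lambda>n. L2_norm N (\<lambda>\<xi>. fourier N (\<phi> n) \<xi> - g \<xi>)) \<longlonglongrightarrow> 0"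
    using assms(1) unfolding has_fourier_L2_def by blast
  obtain \<psi> where \<psi>: "\<And>n. in_L1 N (\<psi> n)" "\<And>n. in_L2 N (\<psi> n)" "\<And>n. in_L2 N (fourier N (\<psi> n))"
      "(\<lambda>n. L2_norm N (\<lambda>x. \<psi> n x - f x)) \<longlonglongrightarrow> 0"
      "(\<lambda>n. L2_norm N (\<lambda>\<xi>. fourier N (\<psi> n) \<xi> - h \<xi>)) \<longlonglongrightarrow> 0"
    using assms(2) unfolding has_fourier_L2_def by blast
  have L2: "in_L2 N f" "in_L2 N g" "in_L2 N h" using assms by (auto simp: has_fourier_L2_def)
  let ?n = "\<lambda>u v. (L2_norm N (\<lambda>x. u x - v x :: complex))\<^sup>2"
  \<comment> \<open>Squared norms with constants replace the triangle inequality of \<open>L\<^sup>2\<close>.\<close>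
  have bound: "?n g h \<le> 4 * ?n (fourier N (\<phi> n)) g + 4 * ?n (fourier N (\<psi> n)) h
      + 2 * (2 * ?n (\<phi> n) f + 2 * ?n (\<psi> n) f)" for n
  proof -
    let ?P = "fourier N (\<phi> n)" and ?Q = "fourier N (\<psi> n)"
    have a: "in_L2 N (\<lambda>x. \<phi> n x - \<psi> n x)" "in_L1 N (\<lambda>x. \<phi> n x - \<psi> n x)"
      using in_L2_diff(1)[OF \<phi>(2)[of n] \<psi>(2)[of n]] \<phi>(1)[of n] \<psi>(1)[of n] by (auto simp: in_L1_def)
    have eq: "fourier N (\<lambda>x. \<phi> n x - \<psi> n x) = (\<lambda>\<xi>. ?P \<xi> - ?Q \<xi>)"
      by (intro ext fourier_diff \<phi> \<psi>)
    have "?n ?P ?Q \<le> ?n (\<phi> n) (\<psi> n)"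
      using L2_norm_fourier_le[OF a(2,1)] unfolding eq by (intro power_mono) (simp_all add: L2_norm_def)
    also have "\<dots> = ?n (\<lambda>x. \<phi> n x - f x) (\<lambda>x. \<psi> n x - f x)" by simp
    also have "\<dots> \<le> 2 * ?n (\<phi> n) f + 2 * ?n (\<psi> n) f"
      by (intro in_L2_diff \<phi> \<psi> L2)
    finally have PQ: "?n ?P ?Q \<le> 2 * ?n (\<phi> n) f + 2 * ?n (\<psi> n) f" .
    have "?n g h = ?n (\<lambda>\<xi>. ?P \<xi> - ?Q \<xi>) (\<lambda>\<xi>. (?P \<xi> - g \<xi>) - (?Q \<xi> - h \<xi>))"
      by (simp add: algebra_simps)
    also have "\<dots> \<le> 2 * ?n ?P ?Q + 2 * ?n (\<lambda>\<xi>. ?P \<xi> - g \<xi>) (\<lambda>\<xi>. ?Q \<xi> - h \<xi>)"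
      by (intro in_L2_diff \<phi> \<psi> L2)
    also have "?n (\<lambda>\<xi>. ?P \<xi> - g \<xi>) (\<lambda>\<xi>. ?Q \<xi> - h \<xi>) \<le> 2 * ?n ?P g + 2 * ?n ?Q h"
      by (intro in_L2_diff \<phi> \<psi> L2)
    finally show ?thesis using PQ by simp
  qed
  have "(\<lambda>n. 4 * ?n (fourier N (\<phi> n)) g + 4 * ?n (fourier N (\<psi> n)) h
      + 2 * (2 * ?n (\<phi> n) f + 2 * ?n (\<psi> n) f)) \<longlonglongrightarrow> 4 * 0\<^sup>2 + 4 * 0\<^sup>2 + 2 * (2 * 0\<^sup>2 + 2 * 0\<^sup>2)"
    by (intro tendsto_intros \<phi> \<psi>)
  then have "?n g h \<le> 0" by (intro LIMSEQ_le_const[of _ _ "?n g h"]) (use bound in auto)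
  then have zero: "L2_norm N (\<lambda>\<xi>. g \<xi> - h \<xi>) = 0" by simp
  have int: "integrable (leb N) (\<lambda>\<xi>. (cmod (g \<xi> - h \<xi>))\<^sup>2)"
    using in_L2_diff(1)[OF L2(2,3)] by (simp add: in_L2_def)
  have "(LINT \<xi>|leb N. (cmod (g \<xi> - h \<xi>))\<^sup>2) = 0" using zero by (simp add: L2_norm_def)
  then have "AE \<xi> in leb N. (cmod (g \<xi> - h \<xi>))\<^sup>2 = 0"
    by (subst (asm) integral_nonneg_eq_0_iff_AE[OF int]) auto
  then show ?thesis by simp
qed

lemma has_fourier_L2_fourier:
  assumes "in_L1 N f" "in_L2 N f" shows "has_fourier_L2 N f (fourier N f)"
  unfolding has_fourier_L2_def
  by (intro conjI exI[of _ "\<lambda>_. f"] allI assms in_L2_fourier) (simp_all add: L2_norm_def)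

lemma fourier_L2_AE:
  assumes "has_fourier_L2 N f g" shows "AE \<xi> in leb N. fourier_L2 N f \<xi> = g \<xi>"
  using has_fourier_L2_unique[OF someI[of "has_fourier_L2 N f" g, OF assms] assms]
  by (simp add: fourier_L2_def)

lemma fourier_L2_measurable [measurable]:
  assumes "has_fourier_L2 N f g" shows "fourier_L2 N f \<in> borel_measurable (leb N)"
proof -
  have "has_fourier_L2 N f (fourier_L2 N f)" unfolding fourier_L2_def by (rule someI[of "has_fourier_L2 N f" g, OF assms])
  then show ?thesis by (simp add: has_fourier_L2_def in_L2_def)
qed

section \<open>Decay of weighted heat integrals\<close>

lemma vnorm_square: "(vnorm N \<xi>)\<^sup>2 = (\<Sum>i<N. (\<xi> i)\<^sup>2)"
  unfolding L2_set_def by (intro real_sqrt_pow2 sum_nonneg) simp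

lemma vnorm_measurable [measurable]: "vnorm N \<in> borel_measurable (leb N)"
  unfolding L2_set_def by measurable

lemma AE_vnorm_pos:
  assumes "1 \<le> N" shows "AE \<xi> in leb N. 0 < vnorm N \<xi>"
proof (rule AE_I)
  show "{\<xi> \<in> space (leb N). \<not> 0 < vnorm N \<xi>} \<subseteq> Pi\<^sub>E {..<N} (\<lambda>_. {0})"
  proof
    fix \<xi> assume "\<xi> \<in> {\<xi> \<in> space (leb N). \<not> 0 < vnorm N \<xi>}"
    then have "\<xi> \<in> space (leb N)" "vnorm N \<xi> = 0" by (auto simp: less_le)
    then show "\<xi> \<in> Pi\<^sub>E {..<N} (\<lambda>_. {0})"
      by (auto simp: L2_set_eq_0_iff space_PiM PiE_iff extensional_def)
  qed
  show "Pi\<^sub>E {..<N} (\<lambda>_. {0}) \<in> sets (leb N)" by (intro sets_PiM_I_finite) auto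
  show "emeasure (leb N) (Pi\<^sub>E {..<N} (\<lambda>_. {0})) = 0"
    using assms by (subst product_sigma_finite.emeasure_PiM[OF product_sigma_finite_lborel]) auto
qed

lemma nn_integral_gaussian_vnorm:
  assumes a: "0 < a"
  shows "(\<integral>\<^sup>+\<xi>. ennreal (exp (- (a * (vnorm N \<xi>)\<^sup>2))) \<partial>leb N) = ennreal (sqrt (pi / a) ^ N)"
proof -
  have eq: "exp (- (a * x\<^sup>2)) = sqrt (pi / a) * normal_density 0 (sqrt (1 / (2 * a))) x" for x
    using a by (simp add: normal_density_def field_simps real_sqrt_divide)
  have one: "(\<integral>\<^sup>+x. ennreal (exp (- (a * x\<^sup>2))) \<partial>lborel) = ennreal (sqrt (pi / a))"
    unfolding eq using a
    by (subst nn_integral_eq_integral) (simp_all add: integrable_normal_density integral_normal_density)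
  have "(\<integral>\<^sup>+\<xi>. ennreal (exp (- (a * (vnorm N \<xi>)\<^sup>2))) \<partial>leb N)
      = (\<integral>\<^sup>+\<xi>. (\<Prod>i<N. ennreal (exp (- (a * (\<xi> i)\<^sup>2)))) \<partial>leb N)"
    by (simp add: vnorm_square sum_distrib_left exp_sum prod_ennreal flip: sum_negf)
  also have "\<dots> = (\<Prod>i<N. \<integral>\<^sup>+x. ennreal (exp (- (a * x\<^sup>2))) \<partial>lborel)"
    by (intro product_sigma_finite.product_nn_integral_prod product_sigma_finite_lborel) auto
  also have "\<dots> = ennreal (sqrt (pi / a) ^ N)"
    using a by (simp add: one ennreal_power)
  finally show ?thesis .
qed

lemma power_le_fact_mult_exp: "0 \<le> x \<Longrightarrow> x ^ j \<le> fact j * exp (x :: real)"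
proof -
  assume x: "0 \<le> x"
  have "(\<Sum>i\<in>{j}. x ^ i / fact i) \<le> (\<Sum>i. x ^ i / fact i)"
    using x summable_exp[of x] by (intro sum_le_suminf) (auto simp: divide_inverse mult.commute)
  also have "\<dots> = exp x" by (simp add: exp_def scaleR_conv_of_real divide_inverse mult.commute)
  finally show ?thesis by (simp add: field_simps)
qed

text \<open>
  Half of the exponent absorbs the power of \<open>R\<close> and turns it into decay in \<open>s\<close>; the other half remains a
  Gaussian in the frequency when \<open>R\<close> is the square of its norm.
\<close>

lemma power_mult_exp_le:
  fixes \<kappa> R s :: real
  assumes "0 < \<kappa>" "0 \<le> R" "0 < s"
  shows "R ^ j * exp (- (\<kappa> * R * s)) \<le> fact j * (2 / (\<kappa> * s)) ^ j * exp (- (\<kappa> * s / 2 * R))"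
proof -
  have "(\<kappa> * R * s / 2) ^ j \<le> fact j * exp (\<kappa> * R * s / 2)"
    using assms by (intro power_le_fact_mult_exp) simp
  then have "(2 / (\<kappa> * s)) ^ j * (\<kappa> * R * s / 2) ^ j \<le> (2 / (\<kappa> * s)) ^ j * (fact j * exp (\<kappa> * R * s / 2))"
    using assms by (intro mult_left_mono) auto
  also have "(2 / (\<kappa> * s)) ^ j * (\<kappa> * R * s / 2) ^ j = R ^ j"
    using assms by (simp flip: power_mult_distrib)
  finally have "R ^ j * exp (- (\<kappa> * R * s))
      \<le> (2 / (\<kappa> * s)) ^ j * (fact j * exp (\<kappa> * R * s / 2)) * exp (- (\<kappa> * R * s))"
    by (intro mult_right_mono) auto
  also have "\<dots> = fact j * (2 / (\<kappa> * s)) ^ j * (exp (\<kappa> * R * s / 2) * exp (- (\<kappa> * R * s)))"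
    by simp
  also have "exp (\<kappa> * R * s / 2) * exp (- (\<kappa> * R * s)) = exp (- (\<kappa> * s / 2 * R))"
    unfolding exp_add[symmetric] by (simp add: field_simps)
  finally show ?thesis .
qed

lemma nn_integral_exp_tail:
  fixes a T :: real assumes "0 < a"
  shows "(\<integral>\<^sup>+s. ennreal (exp (- (a * s))) * indicator {T..} s \<partial>lborel) = ennreal (exp (- (a * T)) / a)"
proof -
  have "filterlim (\<lambda>s. - (a * s)) at_bot at_top"
    unfolding filterlim_uminus_at_bot minus_minus
    by (rule filterlim_tendsto_pos_mult_at_top[OF tendsto_const assms filterlim_ident])
  then have "((\<lambda>s. exp (- (a * s))) \<longlongrightarrow> 0) at_top" by (rule filterlim_compose[OF exp_at_bot])
  then have "((\<lambda>s. - (exp (- (a * s)) / a)) \<longlongrightarrow> 0) at_top"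
    using tendsto_minus[OF tendsto_divide_zero] by fastforce
  then have "(\<integral>\<^sup>+s. ennreal (exp (- (a * s))) * indicator {T..} s \<partial>lborel) = ennreal (0 - (- (exp (- (a * T)) / a)))"
    using assms by (intro nn_integral_FTC_atLeast) (auto intro!: derivative_eq_intros)
  then show ?thesis by simp
qed

lemma nn_integral_powr_tail:
  fixes p T :: real assumes "1 < p" "0 < T"
  shows "(\<integral>\<^sup>+s. ennreal (s powr (- p)) * indicator {T..} s \<partial>lborel) = ennreal (T powr (1 - p) / (p - 1))"
proof -
  have "((\<lambda>s. s powr (1 - p)) \<longlongrightarrow> 0) at_top"
    using assms by (intro tendsto_neg_powr filterlim_ident) simp
  then have lim: "((\<lambda>s. - (s powr (1 - p) / (p - 1))) \<longlongrightarrow> 0) at_top"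
    using tendsto_minus[OF tendsto_divide_zero] by fastforce
  have der: "((\<lambda>s. - (s powr (1 - p) / (p - 1))) has_real_derivative s powr (- p)) (at s)"
    if "T \<le> s" for s
  proof -
    have "((\<lambda>s. - (s powr (1 - p) / (p - 1))) has_real_derivative
        - ((1 - p) * s powr (1 - p - 1) / (p - 1))) (at s)"
      using that assms by (intro DERIV_minus DERIV_cdivide has_real_derivative_powr) simp
    moreover have "- ((1 - p) * X / (p - 1)) = X" for X using assms(1) by (simp add: field_simps)
    ultimately show ?thesis by simp
  qed
  have "(\<integral>\<^sup>+s. ennreal (s powr (- p)) * indicator {T..} s \<partial>lborel)
      = ennreal (0 - (- (T powr (1 - p) / (p - 1))))"
    by (intro nn_integral_FTC_atLeast der lim) auto
  then show ?thesis by simp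
qed

text \<open>
  Writing \<open>exp (- \<kappa> R T) / R\<close> as \<open>\<kappa>\<close> times the integral of \<open>exp (- \<kappa> R s)\<close> over \<open>s \<ge> T\<close> removes the
  singularity at \<open>R = 0\<close>, so that only Gaussian integrals in the frequency remain. At \<open>R = 0\<close> the
  left-hand side is 0, by division by zero.
\<close>

lemma frequency_tail_bound:
  fixes \<kappa> R T :: real
  assumes "0 < \<kappa>" "0 \<le> R"
  shows "ennreal (R ^ j / R * exp (- (\<kappa> * R * T)))
    \<le> (\<integral>\<^sup>+s. ennreal (\<kappa> * (R ^ j * exp (- (\<kappa> * R * s)))) * indicator {T..} s \<partial>lborel)"
proof (cases "R = 0")
  case False
  then have R: "0 < R" using assms by simp
  then have a: "0 < \<kappa> * R" using assms by simp
  have A: "0 \<le> \<kappa> * R ^ j" using assms by simp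
  have "ennreal (\<kappa> * (R ^ j * exp (- (\<kappa> * R * s)))) * indicator {T..} s
      = ennreal (\<kappa> * R ^ j) * (ennreal (exp (- (\<kappa> * R * s))) * indicator {T..} s)" for s
    by (simp only: ennreal_mult[OF A exp_ge_zero] mult.assoc[symmetric])
  then have "(\<integral>\<^sup>+s. ennreal (\<kappa> * (R ^ j * exp (- (\<kappa> * R * s)))) * indicator {T..} s \<partial>lborel)
     = (\<integral>\<^sup>+s. ennreal (\<kappa> * R ^ j) * (ennreal (exp (- (\<kappa> * R * s))) * indicator {T..} s) \<partial>lborel)"
    by simp
  also have "\<dots> = ennreal (\<kappa> * R ^ j) * ennreal (exp (- (\<kappa> * R * T)) / (\<kappa> * R))"
    unfolding nn_integral_exp_tail[OF a, symmetric] by (rule nn_integral_cmult) measurable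
  also have "\<dots> = ennreal (\<kappa> * R ^ j * (exp (- (\<kappa> * R * T)) / (\<kappa> * R)))"
    using a by (intro ennreal_mult[symmetric] A) simp
  also have "\<kappa> * R ^ j * (exp (- (\<kappa> * R * T)) / (\<kappa> * R)) = R ^ j / R * exp (- (\<kappa> * R * T))"
    using assms R by simp
  finally show ?thesis by simp
qed simp

lemma frequency_gaussian_bound:
  fixes \<kappa> s :: real
  assumes \<kappa>: "0 < \<kappa>" and s: "0 < s"
  shows "(\<integral>\<^sup>+\<xi>. ennreal (\<kappa> * (((vnorm N \<xi>)\<^sup>2) ^ j * exp (- (\<kappa> * (vnorm N \<xi>)\<^sup>2 * s)))) \<partial>leb N)
    \<le> ennreal (\<kappa> * (fact j * (2 / \<kappa>) ^ j * (2 * pi / \<kappa>) powr (real N / 2)) * s powr (- (real j + real N / 2)))"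
proof -
  define A where "A = \<kappa> * (fact j * (2 / (\<kappa> * s)) ^ j)"
  have A: "0 \<le> A" using \<kappa> s by (simp add: A_def)
  have a: "0 < \<kappa> * s / 2" using \<kappa> s by simp
  have "\<kappa> * (((vnorm N \<xi>)\<^sup>2) ^ j * exp (- (\<kappa> * (vnorm N \<xi>)\<^sup>2 * s)))
      \<le> A * exp (- (\<kappa> * s / 2 * (vnorm N \<xi>)\<^sup>2))" for \<xi>
    using mult_left_mono[OF power_mult_exp_le[OF \<kappa> zero_le_power2 s, of "vnorm N \<xi>" j] less_imp_le[OF \<kappa>]]
    by (simp only: A_def mult.assoc)
  then have "(\<integral>\<^sup>+\<xi>. ennreal (\<kappa> * (((vnorm N \<xi>)\<^sup>2) ^ j * exp (- (\<kappa> * (vnorm N \<xi>)\<^sup>2 * s)))) \<partial>leb N)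
      \<le> (\<integral>\<^sup>+\<xi>. ennreal A * ennreal (exp (- (\<kappa> * s / 2 * (vnorm N \<xi>)\<^sup>2))) \<partial>leb N)"
    unfolding ennreal_mult[OF A exp_ge_zero, symmetric] by (intro nn_integral_mono ennreal_leI)
  also have "\<dots> = ennreal A * ennreal (sqrt (pi / (\<kappa> * s / 2)) ^ N)"
    unfolding nn_integral_gaussian_vnorm[OF a, symmetric] by (rule nn_integral_cmult) measurable
  also have "\<dots> = ennreal (A * sqrt (pi / (\<kappa> * s / 2)) ^ N)"
    using \<kappa> s by (intro ennreal_mult[symmetric] A) simp
  also have "A * sqrt (pi / (\<kappa> * s / 2)) ^ N = \<kappa> * (fact j * (2 / \<kappa>) ^ j * (2 * pi / \<kappa>) powr (real N / 2))
      * s powr (- (real j + real N / 2))"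
  proof -
    have "pi / (\<kappa> * s / 2) = (2 * pi / \<kappa>) * inverse s" using \<kappa> s by (simp add: field_simps)
    moreover have "sqrt x ^ N = x powr (real N / 2)" if "0 < x" for x
    proof -
      have "sqrt x ^ N = (x powr (1 / 2)) powr real N"
        using that by (simp add: powr_half_sqrt powr_realpow)
      then show ?thesis by (simp add: powr_powr)
    qed
    ultimately have "sqrt (pi / (\<kappa> * s / 2)) ^ N = ((2 * pi / \<kappa>) * inverse s) powr (real N / 2)"
      using \<kappa> s by simp
    also have "\<dots> = (2 * pi / \<kappa>) powr (real N / 2) * inverse s powr (real N / 2)"
      by (rule powr_mult)
    also have "inverse s powr (real N / 2) = s powr (- (real N / 2))"
      using s by (simp add: inverse_powr powr_minus)
    finally have e1: "sqrt (pi / (\<kappa> * s / 2)) ^ N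
        = (2 * pi / \<kappa>) powr (real N / 2) * s powr (- (real N / 2))" .
    have "(2 / (\<kappa> * s)) ^ j = (2 / \<kappa>) ^ j * inverse (s ^ j)"
      by (simp add: power_divide power_mult_distrib divide_inverse power_inverse)
    also have "inverse (s ^ j) = s powr (- real j)" using s by (simp add: powr_minus powr_realpow)
    finally have e2: "(2 / (\<kappa> * s)) ^ j = (2 / \<kappa>) ^ j * s powr (- real j)" .
    have e3: "s powr (- (real j + real N / 2)) = s powr (- real j) * s powr (- (real N / 2))"
      by (simp flip: powr_add)
    show ?thesis unfolding A_def e1 e2 e3 by (simp only: mult_ac)
  qed
  finally show ?thesis .
qed

text \<open>
  Exchange the integrals over \<open>\<xi>\<close> and \<open>s\<close>. The Gaussian integral over \<open>\<xi>\<close> is of order \<open>s powr (- p)\<close> with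
  \<open>p = j + N / 2\<close>, and integrating over \<open>s \<ge> T\<close> gains one power. The condition on \<open>N\<close> and \<open>j\<close> says
  \<open>p > 1\<close>, which is the integrability of \<open>s powr (- p)\<close> at infinity.
\<close>

lemma low_frequency_nn_integral:
  fixes \<kappa> T :: real
  assumes \<kappa>: "0 < \<kappa>" and Nj: "3 \<le> N + 2 * j" and T: "0 < T"
  defines "p \<equiv> real j + real N / 2"
  shows "(\<integral>\<^sup>+\<xi>. ennreal ((vnorm N \<xi>) ^ (2 * j) / (vnorm N \<xi>)\<^sup>2 * exp (- (\<kappa> * (vnorm N \<xi>)\<^sup>2 * T))) \<partial>leb N)
    \<le> ennreal (\<kappa> * (fact j * (2 / \<kappa>) ^ j * (2 * pi / \<kappa>) powr (real N / 2)) / (p - 1) * T powr (1 - p))"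
proof -
  interpret P: pair_sigma_finite "leb N" "lborel :: real measure"
    by (intro pair_sigma_finite.intro sigma_finite_leb sigma_finite_lborel)
  define R where "R \<xi> = (vnorm N \<xi>)\<^sup>2" for \<xi>
  define K where "K = \<kappa> * (fact j * (2 / \<kappa>) ^ j * (2 * pi / \<kappa>) powr (real N / 2))"
  have K: "0 \<le> K" using \<kappa> by (simp add: K_def)
  have p: "1 < p" using Nj by (simp add: p_def field_simps)
  have R0: "0 \<le> R \<xi>" for \<xi> by (simp add: R_def)
  have [measurable]: "R \<in> borel_measurable (leb N)" unfolding R_def by measurable
  have "(\<integral>\<^sup>+\<xi>. ennreal ((vnorm N \<xi>) ^ (2 * j) / (vnorm N \<xi>)\<^sup>2 * exp (- (\<kappa> * (vnorm N \<xi>)\<^sup>2 * T))) \<partial>leb N)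
      = (\<integral>\<^sup>+\<xi>. ennreal (R \<xi> ^ j / R \<xi> * exp (- (\<kappa> * R \<xi> * T))) \<partial>leb N)"
    by (simp only: R_def power_mult)
  also have "\<dots>
      \<le> (\<integral>\<^sup>+\<xi>. \<integral>\<^sup>+s. ennreal (\<kappa> * (R \<xi> ^ j * exp (- (\<kappa> * R \<xi> * s)))) * indicator {T..} s \<partial>lborel \<partial>leb N)"
    by (intro nn_integral_mono frequency_tail_bound \<kappa> R0)
  also have "\<dots> = (\<integral>\<^sup>+s. \<integral>\<^sup>+\<xi>. ennreal (\<kappa> * (R \<xi> ^ j * exp (- (\<kappa> * R \<xi> * s)))) * indicator {T..} s \<partial>leb N \<partial>lborel)"
    by (rule P.Fubini'[symmetric]) measurable
  also have "\<dots> \<le> (\<integral>\<^sup>+s. ennreal K * (ennreal (s powr (- p)) * indicator {T..} s) \<partial>lborel)"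
  proof (intro nn_integral_mono)
    fix s :: real
    show "(\<integral>\<^sup>+\<xi>. ennreal (\<kappa> * (R \<xi> ^ j * exp (- (\<kappa> * R \<xi> * s)))) * indicator {T..} s \<partial>leb N)
      \<le> ennreal K * (ennreal (s powr (- p)) * indicator {T..} s)"
    proof (cases "T \<le> s")
      case True
      then have s: "0 < s" using T by simp
      have "(\<integral>\<^sup>+\<xi>. ennreal (\<kappa> * (R \<xi> ^ j * exp (- (\<kappa> * R \<xi> * s)))) \<partial>leb N) \<le> ennreal (K * s powr (- p))"
        unfolding R_def K_def p_def by (rule frequency_gaussian_bound[OF \<kappa> s])
      also have "\<dots> = ennreal K * ennreal (s powr (- p))" using K by (intro ennreal_mult) simp_all
      finally show ?thesis using True by simp
    qed simp
  qed
  also have "\<dots> = ennreal K * ennreal (T powr (1 - p) / (p - 1))"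
    unfolding nn_integral_powr_tail[OF p T, symmetric] by (rule nn_integral_cmult) measurable
  also have "\<dots> = ennreal (K * (T powr (1 - p) / (p - 1)))"
    using K p by (intro ennreal_mult[symmetric]) simp_all
  also have "K * (T powr (1 - p) / (p - 1)) = K / (p - 1) * T powr (1 - p)" by simp
  finally show ?thesis unfolding K_def .
qed

text \<open>
  The quotient stands for the power \<open>2 j - 2\<close>, which is negative for \<open>j = 0\<close>.
\<close>

definition heat_weight :: "nat \<Rightarrow> nat \<Rightarrow> real \<Rightarrow> real \<Rightarrow> (nat \<Rightarrow> real) \<Rightarrow> real"
  where "heat_weight N j \<kappa> T \<xi> = (vnorm N \<xi>) ^ (2 * j) / (vnorm N \<xi>)\<^sup>2 * exp (- (\<kappa> * (vnorm N \<xi>)\<^sup>2 * T))"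

definition heat_weight_decay :: "nat \<Rightarrow> nat \<Rightarrow> real \<Rightarrow> real \<Rightarrow> bool"
  where "heat_weight_decay N j \<kappa> C \<longleftrightarrow> 0 \<le> C \<and>
    (\<forall>T>0. integrable (leb N) (heat_weight N j \<kappa> T) \<and>
      (LINT \<xi>|leb N. heat_weight N j \<kappa> T \<xi>) \<le> C * T powr (- (real N - 2) / 2 - real j))"

lemma heat_weight_decay_exists:
  fixes \<kappa> :: real
  assumes \<kappa>: "0 < \<kappa>" and Nj: "3 \<le> N + 2 * j"
  shows "\<exists>C. heat_weight_decay N j \<kappa> C"
proof -
  define p where "p = real j + real N / 2"
  define C where "C = \<kappa> * (fact j * (2 / \<kappa>) ^ j * (2 * pi / \<kappa>) powr (real N / 2)) / (p - 1)"
  let ?G = "heat_weight N j \<kappa>"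
  have p: "1 < p" using Nj by (simp add: p_def field_simps)
  have C: "0 \<le> C" using p \<kappa> by (simp add: C_def)
  have e: "1 - p = - (real N - 2) / 2 - real j" by (simp add: p_def field_simps)
  have nn: "(\<integral>\<^sup>+\<xi>. ennreal (?G T \<xi>) \<partial>leb N) \<le> ennreal (C * T powr (- (real N - 2) / 2 - real j))" if "0 < T" for T
    using low_frequency_nn_integral[OF \<kappa> Nj that] by (simp only: heat_weight_def C_def p_def[symmetric] e)
  have G0: "0 \<le> ?G T \<xi>" for T \<xi> by (simp add: heat_weight_def)
  have int: "integrable (leb N) (?G T)" if "0 < T" for T
  proof (rule integrableI_nonneg)
    show "?G T \<in> borel_measurable (leb N)" unfolding heat_weight_def by measurable
    show "(\<integral>\<^sup>+\<xi>. ennreal (?G T \<xi>) \<partial>leb N) < \<infinity>"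
      using nn[OF that] by (rule order.strict_trans1) simp
  qed (simp add: G0)
  have "(LINT \<xi>|leb N. ?G T \<xi>) \<le> C * T powr (- (real N - 2) / 2 - real j)" if T: "0 < T" for T
  proof -
    have "ennreal (LINT \<xi>|leb N. ?G T \<xi>) \<le> ennreal (C * T powr (- (real N - 2) / 2 - real j))"
      using nn[OF T] by (subst nn_integral_eq_integral[symmetric]) (auto simp: int T G0)
    then show ?thesis using C by (subst (asm) ennreal_le_iff) auto
  qed
  with C int show ?thesis unfolding heat_weight_decay_def by blast
qed

section \<open>From modes to the solution\<close>

lemma sum_squares_le_square_sum:
  fixes a b c :: real
  assumes "0 \<le> a" "0 \<le> b" "0 \<le> c"
  shows "a\<^sup>2 + b\<^sup>2 + c\<^sup>2 \<le> (a + b + c)\<^sup>2"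
proof -
  have "(a + b + c)\<^sup>2 - (a\<^sup>2 + b\<^sup>2 + c\<^sup>2) = 2 * (a * b) + 2 * (a * c) + 2 * (b * c)"
    by (simp add: power2_eq_square algebra_simps)
  also have "\<dots> \<ge> 0" using assms by (intro add_nonneg_nonneg mult_nonneg_nonneg) simp_all
  finally show ?thesis by simp
qed

lemma power_le_one_plus_powr:
  fixes R s :: real
  assumes "0 \<le> R" "real j \<le> s" shows "R ^ j \<le> (1 + R) powr s"
proof -
  have "R ^ j \<le> (1 + R) ^ j" using assms by (intro power_mono) auto
  also have "\<dots> = (1 + R) powr real j" using assms by (simp add: powr_realpow)
  also have "\<dots> \<le> (1 + R) powr s" using assms by (intro powr_mono) auto
  finally show ?thesis .
qed

lemma one_plus_power_le:
  fixes R :: real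
  assumes "0 \<le> R" shows "(1 + R) ^ j \<le> 2 ^ j * (1 + R ^ j)"
proof (cases "R \<le> 1")
  case True
  then have "(1 + R) ^ j \<le> 2 ^ j" using assms by (intro power_mono) auto
  also have "\<dots> \<le> 2 ^ j * (1 + R ^ j)" using assms by simp
  finally show ?thesis .
next
  case False
  then have "(1 + R) ^ j \<le> (2 * R) ^ j" using assms by (intro power_mono) auto
  also have "\<dots> = 2 ^ j * R ^ j" by (rule power_mult_distrib)
  also have "\<dots> \<le> 2 ^ j * (1 + R ^ j)" by (intro mult_left_mono) auto
  finally show ?thesis .
qed

text \<open>
  The derivative norms are defined through the Plancherel transform; for data in \<open>L\<^sup>1\<close> the integral
  transform agrees with it almost everywhere, by uniqueness.
\<close>

lemma data_weighted_integral:
  assumes f: "in_L1 N f" "in_Hs N s f" and j: "real j \<le> s"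
  shows "integrable (leb N) (\<lambda>\<xi>. (vnorm N \<xi>) ^ (2 * j) * (cmod (fourier N f \<xi>))\<^sup>2)"
    and "(LINT \<xi>|leb N. (vnorm N \<xi>) ^ (2 * j) * (cmod (fourier N f \<xi>))\<^sup>2) = (deriv_L2_norm N j f)\<^sup>2"
proof -
  have f2: "in_L2 N f" and int: "integrable (leb N) (\<lambda>\<xi>. (1 + (vnorm N \<xi>)\<^sup>2) powr s * (cmod (fourier_L2 N f \<xi>))\<^sup>2)"
    using f(2) by (auto simp: in_Hs_def)
  have F: "has_fourier_L2 N f (fourier N f)" by (rule has_fourier_L2_fourier[OF f(1) f2])
  note [measurable] = fourier_L2_measurable[OF F] fourier_measurable[OF f(1)]
  note ae = fourier_L2_AE[OF F]
  have int': "integrable (leb N) (\<lambda>\<xi>. (vnorm N \<xi>) ^ (2 * j) * (cmod (fourier_L2 N f \<xi>))\<^sup>2)"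
  proof (rule Bochner_Integration.integrable_bound[OF int])
    show "(\<lambda>\<xi>. (vnorm N \<xi>) ^ (2 * j) * (cmod (fourier_L2 N f \<xi>))\<^sup>2) \<in> borel_measurable (leb N)"
      by measurable
    show "AE \<xi> in leb N. norm ((vnorm N \<xi>) ^ (2 * j) * (cmod (fourier_L2 N f \<xi>))\<^sup>2)
        \<le> norm ((1 + (vnorm N \<xi>)\<^sup>2) powr s * (cmod (fourier_L2 N f \<xi>))\<^sup>2)"
      using power_le_one_plus_powr[OF zero_le_power2 j]
      by (intro AE_I2) (simp add: abs_mult power_mult mult_right_mono)
  qed
  have eq: "AE \<xi> in leb N. (vnorm N \<xi>) ^ (2 * j) * (cmod (fourier_L2 N f \<xi>))\<^sup>2
      = (vnorm N \<xi>) ^ (2 * j) * (cmod (fourier N f \<xi>))\<^sup>2"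
    using ae by eventually_elim simp
  show "integrable (leb N) (\<lambda>\<xi>. (vnorm N \<xi>) ^ (2 * j) * (cmod (fourier N f \<xi>))\<^sup>2)"
    by (rule integrable_cong_AE_imp[OF int' _ eq]) measurable
  have "(LINT \<xi>|leb N. (vnorm N \<xi>) ^ (2 * j) * (cmod (fourier N f \<xi>))\<^sup>2)
      = (LINT \<xi>|leb N. (vnorm N \<xi>) ^ (2 * j) * (cmod (fourier_L2 N f \<xi>))\<^sup>2)"
    by (rule integral_cong_AE[OF _ _ AE_symmetric[OF eq]]) measurable
  also have "\<dots> = (deriv_L2_norm N j f)\<^sup>2"
    unfolding deriv_L2_norm_def by (subst real_sqrt_pow2) (simp_all add: integral_nonneg_AE)
  finally show "(LINT \<xi>|leb N. (vnorm N \<xi>) ^ (2 * j) * (cmod (fourier N f \<xi>))\<^sup>2) = (deriv_L2_norm N j f)\<^sup>2" .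
qed

text \<open>
  The first term accounts for \<open>r \<le> 1\<close>, where the factor \<open>1 / r\<^sup>2\<close> stays and the data are bounded by
  the constant \<open>A\<close>; the second for \<open>r \<ge> 1\<close>, where the decay is uniform and the data keep their weight.
\<close>

lemma frequency_split_bound:
  fixes r \<kappa> C t D A Y :: real
  assumes r: "0 < r" and \<kappa>: "0 < \<kappa>" and C: "0 \<le> C" and D: "0 \<le> D" "D \<le> A" and t: "0 \<le> t"
    and le: "r\<^sup>2 * Y \<le> C * max 1 (r\<^sup>2) * exp (- \<kappa> * min 1 (r\<^sup>2) * t) * D"
  shows "r ^ (2 * j) * Y \<le> C * exp \<kappa> * A * (r ^ (2 * j) / r\<^sup>2 * exp (- (\<kappa> * r\<^sup>2 * (1 + t))))
    + C * exp (- \<kappa> * t) * (r ^ (2 * j) * D)"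
proof -
  have r2: "0 < r\<^sup>2" using r by simp
  define w where "w = r ^ (2 * j)"
  have w: "0 \<le> w" using r by (simp add: w_def)
  have A: "0 \<le> A" using D by simp
  show ?thesis
  proof (cases "r\<^sup>2 \<le> 1")
    case True
    \<comment> \<open>The factor \<open>exp \<kappa>\<close> pays for replacing \<open>t\<close> by \<open>1 + t\<close>, which keeps the bound finite at \<open>t = 0\<close>.\<close>
    have "\<kappa> * r\<^sup>2 \<le> \<kappa>" using True \<kappa> by simp
    then have "exp (- \<kappa> * r\<^sup>2 * t) \<le> exp (\<kappa> + - (\<kappa> * r\<^sup>2 * (1 + t)))" by (simp add: algebra_simps)
    then have e: "exp (- \<kappa> * r\<^sup>2 * t) \<le> exp \<kappa> * exp (- (\<kappa> * r\<^sup>2 * (1 + t)))" by (simp only: exp_add)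
    have "r\<^sup>2 * Y \<le> C * exp (- \<kappa> * r\<^sup>2 * t) * D" using le True by (simp add: max_absorb1 min_absorb2)
    also have "\<dots> \<le> C * (exp \<kappa> * exp (- (\<kappa> * r\<^sup>2 * (1 + t)))) * A"
      using e C D A by (intro mult_mono) auto
    finally have "Y \<le> C * (exp \<kappa> * exp (- (\<kappa> * r\<^sup>2 * (1 + t)))) * A / r\<^sup>2"
      using r2 by (simp add: pos_le_divide_eq mult.commute)
    then have "w * Y \<le> w * (C * (exp \<kappa> * exp (- (\<kappa> * r\<^sup>2 * (1 + t)))) * A / r\<^sup>2)"
      using w by (rule mult_left_mono)
    also have "\<dots> = C * exp \<kappa> * A * (w / r\<^sup>2 * exp (- (\<kappa> * r\<^sup>2 * (1 + t))))" by simp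
    finally have *: "w * Y \<le> C * exp \<kappa> * A * (w / r\<^sup>2 * exp (- (\<kappa> * r\<^sup>2 * (1 + t))))" .
    have "0 \<le> C * exp (- \<kappa> * t) * (w * D)" using C D w by simp
    with * show ?thesis unfolding w_def[symmetric] by linarith
  next
    case False
    then have "r\<^sup>2 * Y \<le> r\<^sup>2 * (C * exp (- \<kappa> * t) * D)" using le by (simp add: max_def min_def mult_ac)
    then have "Y \<le> C * exp (- \<kappa> * t) * D" using r2 by (rule mult_left_le_imp_le)
    then have "w * Y \<le> w * (C * exp (- \<kappa> * t) * D)" using w by (rule mult_left_mono)
    then have *: "w * Y \<le> C * exp (- \<kappa> * t) * (w * D)" by (simp only: mult_ac)
    have "0 \<le> C * exp \<kappa> * A * (w / r\<^sup>2 * exp (- (\<kappa> * r\<^sup>2 * (1 + t))))" using C A w by simp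
    with * show ?thesis unfolding w_def[symmetric] by linarith
  qed
qed

text \<open>
  Integrate \<open>frequency_split_bound\<close>, with \<open>A\<close> the square of the sum of the \<open>L\<^sup>1\<close> norms, and take square
  roots, which halves both the exponent of \<open>1 + t\<close> and the exponential rate.
\<close>

lemma solution_decay:
  fixes \<kappa> C0 CL \<tau> \<beta> t s :: real
  assumes N: "1 \<le> N" and j: "real j \<le> s" and \<kappa>: "0 < \<kappa>" and C0: "0 < C0" and t: "0 \<le> t"
    and data: "in_L1 N u0" "in_Hs N s u0" "in_L1 N u1" "in_Hs N s u1" "in_L1 N u2" "in_Hs N s u2"
    and sol: "mgt_solution N \<tau> \<beta> u0 u1 u2 u"
    and mode: "mode_decay \<tau> \<beta> \<kappa> C0"
    and heat: "heat_weight_decay N j \<kappa> CL"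
  shows "in_Hs N (real j) (u t)" and "deriv_L2_norm N j (u t)
    \<le> sqrt (C0 * exp \<kappa> * CL) * (L1_norm N u0 + L1_norm N u1 + L1_norm N u2)
        * (1 + t) powr (- (real N - 2) / 4 - real j / 2)
      + sqrt C0 * (deriv_L2_norm N j u0 + deriv_L2_norm N j u1 + deriv_L2_norm N j u2)
        * exp (- (\<kappa> / 2) * t)"
proof -
  obtain U where U: "has_fourier_L2 N (u t) (\<lambda>\<xi>. U \<xi> t)"
    and ode: "\<And>\<xi>. \<xi> \<in> space (leb N) \<Longrightarrow>
      mgt_ode \<tau> \<beta> (vnorm N \<xi>) (fourier N u0 \<xi>) (fourier N u1 \<xi>) (fourier N u2 \<xi>) (U \<xi>)"
  proof -
    from sol obtain U where U: "\<forall>t\<ge>0. has_fourier_L2 N (u t) (\<lambda>\<xi>. U \<xi> t)"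
      and ode: "\<forall>\<xi>\<in>space (leb N).
        mgt_ode \<tau> \<beta> (vnorm N \<xi>) (fourier N u0 \<xi>) (fourier N u1 \<xi>) (fourier N u2 \<xi>) (U \<xi>)"
      unfolding mgt_solution_def by (elim exE conjE)
    show ?thesis by (rule that[OF U[rule_format, OF t] ode[rule_format]])
  qed
  have U2: "in_L2 N (u t)" "in_L2 N (\<lambda>\<xi>. U \<xi> t)" using U by (auto simp: has_fourier_L2_def)
  have [measurable]: "(\<lambda>\<xi>. U \<xi> t) \<in> borel_measurable (leb N)" using U2 by (simp add: in_L2_def)
  note [measurable] = fourier_L2_measurable[OF U]
  note aeU = fourier_L2_AE[OF U]
  define w where "w \<xi> = (vnorm N \<xi>) ^ (2 * j)" for \<xi>
  have [measurable]: "w \<in> borel_measurable (leb N)" unfolding w_def by measurable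
  have w0: "0 \<le> w \<xi>" for \<xi> by (simp add: w_def power_mult)
  define G where "G = heat_weight N j \<kappa> (1 + t)"
  define D where "D \<xi> = (cmod (fourier N u0 \<xi>))\<^sup>2 + (cmod (fourier N u1 \<xi>))\<^sup>2 + (cmod (fourier N u2 \<xi>))\<^sup>2" for \<xi>
  define A where "A = L1_norm N u0 + L1_norm N u1 + L1_norm N u2"
  define d where "d = deriv_L2_norm N j u0 + deriv_L2_norm N j u1 + deriv_L2_norm N j u2"
  have L1: "0 \<le> L1_norm N f" for f by (simp add: L1_norm_def)
  have d0: "0 \<le> deriv_L2_norm N j f" for f
    by (simp add: deriv_L2_norm_def integral_nonneg_AE power_mult)
  have A0: "0 \<le> A" using L1 by (simp add: A_def)
  have D0: "0 \<le> D \<xi>" for \<xi> by (simp add: D_def)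
  have DA: "D \<xi> \<le> A\<^sup>2" for \<xi>
  proof -
    have "D \<xi> \<le> (L1_norm N u0)\<^sup>2 + (L1_norm N u1)\<^sup>2 + (L1_norm N u2)\<^sup>2"
      unfolding D_def by (intro add_mono power_mono norm_fourier_le) auto
    also have "\<dots> \<le> A\<^sup>2" unfolding A_def by (intro sum_squares_le_square_sum L1)
    finally show ?thesis .
  qed
  have wD: "w \<xi> * D \<xi> = w \<xi> * (cmod (fourier N u0 \<xi>))\<^sup>2 + w \<xi> * (cmod (fourier N u1 \<xi>))\<^sup>2
      + w \<xi> * (cmod (fourier N u2 \<xi>))\<^sup>2" for \<xi>
    by (simp add: D_def distrib_left)
  note ints = data_weighted_integral(1)[OF data(1,2) j, folded w_def]
    data_weighted_integral(1)[OF data(3,4) j, folded w_def]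
    data_weighted_integral(1)[OF data(5,6) j, folded w_def]
  note vals = data_weighted_integral(2)[OF data(1,2) j, folded w_def]
    data_weighted_integral(2)[OF data(3,4) j, folded w_def]
    data_weighted_integral(2)[OF data(5,6) j, folded w_def]
  have wD_int: "integrable (leb N) (\<lambda>\<xi>. w \<xi> * D \<xi>)"
    unfolding wD by (intro Bochner_Integration.integrable_add ints)
  have wD_le: "(LINT \<xi>|leb N. w \<xi> * D \<xi>) \<le> d\<^sup>2"
  proof -
    have "(LINT \<xi>|leb N. w \<xi> * D \<xi>)
        = (deriv_L2_norm N j u0)\<^sup>2 + (deriv_L2_norm N j u1)\<^sup>2 + (deriv_L2_norm N j u2)\<^sup>2"
      unfolding wD vals[symmetric]
      by (subst Bochner_Integration.integral_add, intro Bochner_Integration.integrable_add ints, rule ints,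
          subst Bochner_Integration.integral_add, rule ints, rule ints, rule refl)
    also have "\<dots> \<le> d\<^sup>2" unfolding d_def by (intro sum_squares_le_square_sum d0)
    finally show ?thesis .
  qed
  define q where "q = - (real N - 2) / 4 - real j / 2"
  have q2: "- (real N - 2) / 2 - real j = q + q" by (simp add: q_def field_simps)
  have t1: "0 < 1 + t" using t by simp
  have CL: "0 \<le> CL" using heat by (simp add: heat_weight_decay_def)
  have Gint: "integrable (leb N) G"
    using heat t1 unfolding heat_weight_decay_def G_def by blast
  have Gle: "(LINT \<xi>|leb N. G \<xi>) \<le> CL * ((1 + t) powr q)\<^sup>2"
  proof -
    have "(LINT \<xi>|leb N. G \<xi>) \<le> CL * (1 + t) powr (- (real N - 2) / 2 - real j)"
      using heat t1 unfolding heat_weight_decay_def G_def by blast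
    then show ?thesis unfolding q2 powr_add power2_eq_square .
  qed
  define Q where "Q \<xi> = C0 * exp \<kappa> * A\<^sup>2 * G \<xi> + C0 * exp (- \<kappa> * t) * (w \<xi> * D \<xi>)" for \<xi>
  have Qint: "integrable (leb N) Q"
    unfolding Q_def[abs_def] by (intro Bochner_Integration.integrable_add integrable_mult_right Gint wD_int)
  have bound: "AE \<xi> in leb N. w \<xi> * (cmod (fourier_L2 N (u t) \<xi>))\<^sup>2 \<le> Q \<xi>"
    using AE_vnorm_pos[OF N] aeU AE_space
  proof eventually_elim
    case (elim \<xi>)
    have "(vnorm N \<xi>)\<^sup>2 * (cmod (U \<xi> t))\<^sup>2
        \<le> C0 * max 1 ((vnorm N \<xi>)\<^sup>2) * exp (- \<kappa> * min 1 ((vnorm N \<xi>)\<^sup>2) * t) * D \<xi>"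
      unfolding D_def using mode ode[OF elim(3)] t unfolding mode_decay_def by blast
    from frequency_split_bound[OF elim(1) \<kappa> less_imp_le[OF C0] D0 DA t this, of j]
    show ?case unfolding elim(2) Q_def G_def heat_weight_def w_def .
  qed
  have Wint: "integrable (leb N) (\<lambda>\<xi>. w \<xi> * (cmod (fourier_L2 N (u t) \<xi>))\<^sup>2)"
  proof (rule Bochner_Integration.integrable_bound[OF Qint])
    show "AE \<xi> in leb N. norm (w \<xi> * (cmod (fourier_L2 N (u t) \<xi>))\<^sup>2) \<le> norm (Q \<xi>)"
      using bound by eventually_elim (simp add: abs_mult w0)
  qed measurable
  have Uint: "integrable (leb N) (\<lambda>\<xi>. (cmod (fourier_L2 N (u t) \<xi>))\<^sup>2)"
  proof (rule integrable_cong_AE_imp)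
    show "integrable (leb N) (\<lambda>\<xi>. (cmod (U \<xi> t))\<^sup>2)" using U2 by (simp add: in_L2_def)
    show "AE \<xi> in leb N. (cmod (U \<xi> t))\<^sup>2 = (cmod (fourier_L2 N (u t) \<xi>))\<^sup>2"
      using aeU by eventually_elim simp
  qed measurable
  show "in_Hs N (real j) (u t)"
    unfolding in_Hs_def
  proof (rule conjI[OF U2(1) Bochner_Integration.integrable_bound])
    show "integrable (leb N) (\<lambda>\<xi>. 2 ^ j * ((cmod (fourier_L2 N (u t) \<xi>))\<^sup>2
        + w \<xi> * (cmod (fourier_L2 N (u t) \<xi>))\<^sup>2))"
      by (intro integrable_mult_right Bochner_Integration.integrable_add Uint Wint)
    have le: "(1 + (vnorm N \<xi>)\<^sup>2) powr real j \<le> 2 ^ j * (1 + w \<xi>)" for \<xi>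
    proof -
      have "(1 + (vnorm N \<xi>)\<^sup>2) powr real j = (1 + (vnorm N \<xi>)\<^sup>2) ^ j"
        by (intro powr_realpow add_pos_nonneg) auto
      also have "\<dots> \<le> 2 ^ j * (1 + w \<xi>)"
        unfolding w_def power_mult by (rule one_plus_power_le) simp
      finally show ?thesis .
    qed
    show "AE \<xi> in leb N. norm ((1 + (vnorm N \<xi>)\<^sup>2) powr real j * (cmod (fourier_L2 N (u t) \<xi>))\<^sup>2)
      \<le> norm (2 ^ j * ((cmod (fourier_L2 N (u t) \<xi>))\<^sup>2 + w \<xi> * (cmod (fourier_L2 N (u t) \<xi>))\<^sup>2))"
    proof (intro AE_I2)
      fix \<xi>
      let ?b = "(cmod (fourier_L2 N (u t) \<xi>))\<^sup>2"
      have "norm ((1 + (vnorm N \<xi>)\<^sup>2) powr real j * ?b) = (1 + (vnorm N \<xi>)\<^sup>2) powr real j * ?b"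
        by (simp only: real_norm_def abs_of_nonneg mult_nonneg_nonneg powr_ge_zero zero_le_power2)
      also have "\<dots> \<le> 2 ^ j * (1 + w \<xi>) * ?b" by (intro mult_right_mono le) simp
      also have "\<dots> = 2 ^ j * (?b + w \<xi> * ?b)" by (simp only: distrib_left distrib_right mult_1_left mult_1_right mult.assoc)
      also have "\<dots> \<le> norm (2 ^ j * (?b + w \<xi> * ?b))" unfolding real_norm_def by (rule abs_ge_self)
      finally show "norm ((1 + (vnorm N \<xi>)\<^sup>2) powr real j * ?b) \<le> norm (2 ^ j * (?b + w \<xi> * ?b))" .
    qed
  qed measurable
  define X where "X = sqrt (C0 * exp \<kappa> * CL) * A * (1 + t) powr q"
  define Y where "Y = sqrt C0 * d * exp (- (\<kappa> / 2) * t)"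
  have X0: "0 \<le> X" using A0 CL C0 by (simp add: X_def)
  have Y0: "0 \<le> Y" using d0 C0 by (simp add: Y_def d_def)
  have "(LINT \<xi>|leb N. w \<xi> * (cmod (fourier_L2 N (u t) \<xi>))\<^sup>2) \<le> (LINT \<xi>|leb N. Q \<xi>)"
    by (rule integral_mono_AE[OF Wint Qint bound])
  also have "\<dots> = C0 * exp \<kappa> * A\<^sup>2 * (LINT \<xi>|leb N. G \<xi>) + C0 * exp (- \<kappa> * t) * (LINT \<xi>|leb N. w \<xi> * D \<xi>)"
    unfolding Q_def integral_mult_right_zero[symmetric]
    by (intro Bochner_Integration.integral_add integrable_mult_right Gint wD_int)
  also have "\<dots> \<le> C0 * exp \<kappa> * A\<^sup>2 * (CL * ((1 + t) powr q)\<^sup>2) + C0 * exp (- \<kappa> * t) * d\<^sup>2"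
    using C0 by (intro add_mono mult_left_mono Gle wD_le) auto
  also have "\<dots> = X\<^sup>2 + Y\<^sup>2"
  proof -
    have e: "(exp (- (\<kappa> / 2) * t))\<^sup>2 = exp (- \<kappa> * t)"
      by (simp add: power2_eq_square flip: exp_add)
    have "X\<^sup>2 = C0 * exp \<kappa> * CL * A\<^sup>2 * ((1 + t) powr q)\<^sup>2"
      unfolding X_def power_mult_distrib using C0 CL by (subst real_sqrt_pow2) simp_all
    moreover have "Y\<^sup>2 = C0 * d\<^sup>2 * exp (- \<kappa> * t)"
      unfolding Y_def power_mult_distrib e using C0 by (subst real_sqrt_pow2) simp_all
    ultimately show ?thesis by (simp only: mult_ac)
  qed
  also have "\<dots> \<le> (X + Y)\<^sup>2" using sum_squares_le_square_sum[OF X0 Y0 order_refl] by simp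
  finally have "sqrt (LINT \<xi>|leb N. w \<xi> * (cmod (fourier_L2 N (u t) \<xi>))\<^sup>2) \<le> X + Y"
    using X0 Y0 by (intro real_le_lsqrt) auto
  then show "deriv_L2_norm N j (u t)
    \<le> sqrt (C0 * exp \<kappa> * CL) * (L1_norm N u0 + L1_norm N u1 + L1_norm N u2)
        * (1 + t) powr (- (real N - 2) / 4 - real j / 2)
      + sqrt C0 * (deriv_L2_norm N j u0 + deriv_L2_norm N j u1 + deriv_L2_norm N j u2)
        * exp (- (\<kappa> / 2) * t)"
    by (simp only: deriv_L2_norm_def w_def X_def Y_def A_def d_def q_def)
qed

theorem theorem4p2:
  fixes \<tau> \<beta> :: real
  assumes "0 < \<tau>" and "\<tau> < \<beta>"
  shows "\<exists>\<nu>0>0. \<forall>\<nu>1. 0 < \<nu>1 \<and> \<nu>1 \<le> \<nu>0 \<longrightarrow>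
    0 < decay_rate \<tau> \<beta> \<nu>1 \<and>
    (\<forall>(N::nat) (s::real). N \<ge> 1 \<and> s \<ge> 1 \<longrightarrow>
      (\<exists>C>0. \<forall>u0 u1 u2 u.
        in_L1 N u0 \<and> in_Hs N s u0 \<and> in_L1 N u1 \<and> in_Hs N s u1 \<and> in_L1 N u2 \<and> in_Hs N s u2 \<and>
        mgt_solution N \<tau> \<beta> u0 u1 u2 u \<longrightarrow>
        (\<forall>j::nat. real j \<le> s \<and> N + j \<ge> 3 \<longrightarrow>
          (\<forall>t\<ge>0. in_Hs N (real j) (u t) \<and>
            deriv_L2_norm N j (u t)
              \<le> C * (L1_norm N u0 + L1_norm N u1 + L1_norm N u2)
                  * (1 + t) powr (- (real N - 2) / 4 - real j / 2)
                + C * (deriv_L2_norm N j u0 + deriv_L2_norm N j u1 + deriv_L2_norm N j u2)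
                  * exp (- decay_rate \<tau> \<beta> \<nu>1 * t)))))"
proof -
  obtain \<kappa> C0 where \<kappa>: "0 < \<kappa>" and C0: "0 < C0" and mode: "mode_decay \<tau> \<beta> \<kappa> C0"
    by (rule mode_decay_exists[OF assms])
  \<comment> \<open>The square root in the final step halves the rate of the modes, so the decay rate must not exceed \<open>\<kappa> / 2\<close>.\<close>
  obtain \<nu>0 where \<nu>0: "0 < \<nu>0" and rate:
    "\<And>\<nu>. 0 < \<nu> \<Longrightarrow> \<nu> \<le> \<nu>0 \<Longrightarrow> 0 < decay_rate \<tau> \<beta> \<nu> \<and> decay_rate \<tau> \<beta> \<nu> \<le> \<kappa> / 2"
    using decay_rate_small[OF assms, of "\<kappa> / 2"] \<kappa> by auto
  show ?thesis
  proof (rule exI[of _ \<nu>0], intro conjI allI impI)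
    show "0 < \<nu>0" by (rule \<nu>0)
    fix \<nu>1 :: real assume \<nu>1: "0 < \<nu>1 \<and> \<nu>1 \<le> \<nu>0"
    then show "0 < decay_rate \<tau> \<beta> \<nu>1" using rate by blast
    have rate_le: "decay_rate \<tau> \<beta> \<nu>1 \<le> \<kappa> / 2" using rate \<nu>1 by blast
    fix N :: nat and s :: real assume Ns: "1 \<le> N \<and> 1 \<le> s"
    have "\<exists>c. 3 \<le> N + j \<longrightarrow> heat_weight_decay N j \<kappa> c" for j
      using heat_weight_decay_exists[OF \<kappa>, of N j] by (cases "3 \<le> N + j") auto
    then obtain CL where heat: "\<And>j. 3 \<le> N + j \<Longrightarrow> heat_weight_decay N j \<kappa> (CL j)"
      using choice[of "\<lambda>j c. 3 \<le> N + j \<longrightarrow> heat_weight_decay N j \<kappa> c"] by blast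
    \<comment> \<open>One constant serves every \<open>j \<le> s\<close>, as there are only finitely many; the absolute value makes every \<open>B j\<close> nonnegative, also where \<open>CL j\<close> is arbitrary.\<close>
    define B where "B j = sqrt (C0 * exp \<kappa> * \<bar>CL j\<bar>)" for j
    define C where "C = sqrt C0 + (\<Sum>j\<le>nat \<lfloor>s\<rfloor>. B j)"
    have B0: "0 \<le> B j" for j using C0 by (simp add: B_def)
    have C_ge0: "sqrt C0 \<le> C" using B0 by (simp add: C_def sum_nonneg)
    have C_geB: "B j \<le> C" if "real j \<le> s" for j
    proof -
      have "j \<le> nat \<lfloor>s\<rfloor>" using that by (simp add: le_nat_floor)
      then have "B j \<le> (\<Sum>j\<le>nat \<lfloor>s\<rfloor>. B j)" by (intro member_le_sum) (auto simp: B0)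
      then show ?thesis using C0 by (simp add: C_def add_increasing)
    qed
    show "\<exists>C>0. \<forall>u0 u1 u2 u.
        in_L1 N u0 \<and> in_Hs N s u0 \<and> in_L1 N u1 \<and> in_Hs N s u1 \<and> in_L1 N u2 \<and> in_Hs N s u2 \<and>
        mgt_solution N \<tau> \<beta> u0 u1 u2 u \<longrightarrow>
        (\<forall>j::nat. real j \<le> s \<and> N + j \<ge> 3 \<longrightarrow>
          (\<forall>t\<ge>0. in_Hs N (real j) (u t) \<and>
            deriv_L2_norm N j (u t)
              \<le> C * (L1_norm N u0 + L1_norm N u1 + L1_norm N u2)
                  * (1 + t) powr (- (real N - 2) / 4 - real j / 2)
                + C * (deriv_L2_norm N j u0 + deriv_L2_norm N j u1 + deriv_L2_norm N j u2)
                  * exp (- decay_rate \<tau> \<beta> \<nu>1 * t)))"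
    proof (rule exI[of _ C], intro conjI[of "C > 0"] allI impI)
      show Cpos: "0 < C" using C_ge0 C0 by (meson less_le_trans real_sqrt_gt_zero)
      fix u0 u1 u2 u and j :: nat and t :: real
      assume H: "in_L1 N u0 \<and> in_Hs N s u0 \<and> in_L1 N u1 \<and> in_Hs N s u1 \<and> in_L1 N u2 \<and> in_Hs N s u2 \<and>
        mgt_solution N \<tau> \<beta> u0 u1 u2 u" and j: "real j \<le> s \<and> 3 \<le> N + j" and t: "0 \<le> t"
      have Nj: "3 \<le> N + j" using j by simp
      have N1: "1 \<le> N" using Ns by simp
      from H have data: "in_L1 N u0" "in_Hs N s u0" "in_L1 N u1" "in_Hs N s u1" "in_L1 N u2" "in_Hs N s u2"
        and sol: "mgt_solution N \<tau> \<beta> u0 u1 u2 u" by auto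
      note est = solution_decay[OF N1 conjunct1[OF j] \<kappa> C0 t data sol mode heat[OF Nj]]
      let ?A = "L1_norm N u0 + L1_norm N u1 + L1_norm N u2"
      let ?d = "deriv_L2_norm N j u0 + deriv_L2_norm N j u1 + deriv_L2_norm N j u2"
      have A0: "0 \<le> ?A" by (simp add: L1_norm_def)
      have d0: "0 \<le> ?d" by (simp add: deriv_L2_norm_def integral_nonneg_AE power_mult)
      have "deriv_L2_norm N j (u t)
          \<le> sqrt (C0 * exp \<kappa> * CL j) * ?A * (1 + t) powr (- (real N - 2) / 4 - real j / 2)
            + sqrt C0 * ?d * exp (- (\<kappa> / 2) * t)" by (rule est(2))
      also have "\<dots> \<le> C * ?A * (1 + t) powr (- (real N - 2) / 4 - real j / 2)
            + C * ?d * exp (- decay_rate \<tau> \<beta> \<nu>1 * t)"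
      proof (intro add_mono mult_mono mult_right_mono)
        show "sqrt (C0 * exp \<kappa> * CL j) \<le> C" using C_geB[of j] heat[OF Nj] j by (simp add: B_def heat_weight_decay_def)
        show "exp (- (\<kappa> / 2) * t) \<le> exp (- decay_rate \<tau> \<beta> \<nu>1 * t)"
          using mult_right_mono[OF rate_le t] by simp
      qed (use A0 d0 Cpos C_ge0 in auto)
      finally show "in_Hs N (real j) (u t) \<and> deriv_L2_norm N j (u t)
          \<le> C * ?A * (1 + t) powr (- (real N - 2) / 4 - real j / 2)
            + C * ?d * exp (- decay_rate \<tau> \<beta> \<nu>1 * t)"
        using est(1) by blast
    qed
  qed
qed

end
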